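(* For every $\varepsilon>0$ there exists $W_0$ such that the following holds. If $W\ge W_0$ and $\mathcal{A}$ is a non-empty bridge-alterable class of graphs on the vertex set $\{1,\ldots,W\}$, and $\mathbf{G}$ is a uniformly random element of $\mathcal{A}$, then \[ \mathbf{P}(\mathbf{G}\text{ is connected})\ \ge\ (1-\varepsilon)\,e^{-1/2}. \]
   Context: Graphs are finite, simple and labelled. A bridge in a graph $G$ is an edge $e$ such that $G-e$ has strictly more connected components than $G$. A set $\mathcal{A}$ of graphs on the vertex set $\{1,\ldots,W\}$ is bridge-alterable if for every graph $G$ on $\{1,\ldots,W\}$ and every bridge $e$ of $G$, we have $G\in\mathcal{A}$ if and only if $G-e\in\mathcal{A}$. *)

theory Defs
  imports "HOL-Probability.Probability"
begin

text \<open>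
  A finite simple labelled graph on a finite vertex set \<open>V\<close> is represented by its edge set, a set of
  two-element subsets of \<open>V\<close>; the vertex set is always passed explicitly.
\<close>

definition graphs_on :: "'a set \<Rightarrow> 'a set set set" where
  "graphs_on V = Pow {e. e \<subseteq> V \<and> card e = 2}"

definition adj_rel :: "'a set set \<Rightarrow> ('a \<times> 'a) set" where
  "adj_rel E = {(u, v). {u, v} \<in> E}"

definition reach_rel :: "'a set \<Rightarrow> 'a set set \<Rightarrow> ('a \<times> 'a) set" where
  "reach_rel V E = {(u, v). u \<in> V \<and> v \<in> V \<and> (u, v) \<in> (adj_rel E)\<^sup>*}"

definition graph_components :: "'a set \<Rightarrow> 'a set set \<Rightarrow> 'a set set" where
  "graph_components V E = V // reach_rel V E"

definition graph_connected :: "'a set \<Rightarrow> 'a set set \<Rightarrow> bool" where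
  "graph_connected V E \<longleftrightarrow> V \<noteq> {} \<and> (\<forall>u\<in>V. \<forall>v\<in>V. (u, v) \<in> reach_rel V E)"

definition is_bridge :: "'a set \<Rightarrow> 'a set set \<Rightarrow> 'a set \<Rightarrow> bool" where
  "is_bridge V E e \<longleftrightarrow>
     e \<in> E \<and> card (graph_components V (E - {e})) > card (graph_components V E)"

definition bridge_alterable :: "'a set \<Rightarrow> 'a set set set \<Rightarrow> bool" where
  "bridge_alterable V A \<longleftrightarrow>
     A \<subseteq> graphs_on V \<and>
     (\<forall>E\<in>graphs_on V. \<forall>e. is_bridge V E e \<longrightarrow> (E \<in> A \<longleftrightarrow> E - {e} \<in> A))"

end

theory Submission
  imports Defs "HOL-Real_Asymp.Real_Asymp"
begin

text \<open>
  Deleting all bridges of a graph partitions a bridge-alterable class into groups. Each group consists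
  of a bridgeless graph \<open>G\<close> together with all ways of adding edges that form a forest on the components
  of \<open>G\<close>; if the components have sizes \<open>w\<close> with sum \<open>W\<close>, a forest counts with weight
  \<open>\<Prod> w\<^sub>v\<^bsup>deg v\<^esup>\<close>. It therefore suffices to compare weighted forests with weighted trees.

  Write \<open>f\<^sub>k\<close> for the weight of the forests with \<open>k\<close> trees. Summing \<open>w(C) + w(C')\<close> over all pairs of
  trees of a forest with \<open>k + 1\<close> trees gives \<open>k W\<close>. Merging the pair, \<open>k W f\<^sub>k\<^sub>+\<^sub>1\<close> is a sum over
  forests with \<open>k\<close> trees in which one tree is split in two. On a vertex set \<open>X\<close> of size \<open>n\<close>, the split
  of one tree contributes exactly
  \<open>\<Sum>v\<in>X. 1 / w v - (n - 2) (n - 3) / (2 w(X))\<close> times the weight of the trees on \<open>X\<close>, by Hurwitz'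
  version of Abel's binomial theorem. Since \<open>w \<ge> 1\<close>, this is at most \<open>w(X) / 2 + 5 / 2\<close>. Hence
  \<open>f\<^sub>k\<^sub>+\<^sub>1 \<le> f\<^sub>k (1 / (2 k) + 5 / (2 W))\<close>, and summing over \<open>k\<close> bounds all forests by
  \<open>(1 + o(1)) e\<^bsup>1/2\<^esup> f\<^sub>1\<close>.
\<close>

section \<open>Subset convolution and the Abel--Hurwitz identities\<close>

text \<open>The labelled form of the product of exponential generating functions; keeping the labels
  lets every vertex carry its own weight.\<close>

definition subset_conv :: "('b set \<Rightarrow> real) \<Rightarrow> ('b set \<Rightarrow> real) \<Rightarrow> 'b set \<Rightarrow> real" where
  "subset_conv f g X = (\<Sum>A\<in>Pow X. f A * g (X - A))"

lemma sum_Pow_complement: "(\<Sum>A\<in>Pow X. f (X - A)) = (\<Sum>A\<in>Pow X. f A)"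
  by (rule sum.reindex_bij_witness[of _ "\<lambda>A. X - A" "\<lambda>A. X - A"]) (auto simp: double_diff)

lemma subset_conv_commute: "subset_conv f g X = subset_conv g f X"
  unfolding subset_conv_def
  by (subst sum_Pow_complement[symmetric])
     (intro sum.cong refl, auto simp: double_diff mult.commute)

text \<open>A chain of \<open>B\<close> inside \<open>A\<close> inside \<open>X\<close> is the same
  as an ordered partition of \<open>X\<close> into \<open>B\<close>, \<open>A - B\<close> and
  \<open>X - A\<close>; this makes the convolution associative.\<close>

lemma sum_Pow_nested:
  assumes "finite X"
  shows "(\<Sum>A\<in>Pow X. \<Sum>B\<in>Pow A. f B (A - B) (X - A)) =
         (\<Sum>B\<in>Pow X. \<Sum>C\<in>Pow (X - B). f B C (X - B - C))"
proof -
  have "(\<Sum>A\<in>Pow X. \<Sum>B\<in>Pow A. f B (A - B) (X - A)) =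
        (\<Sum>(A, B)\<in>(SIGMA A:Pow X. Pow A). f B (A - B) (X - A))"
    using assms by (subst sum.Sigma) (auto intro: finite_subset)
  also have "\<dots> = (\<Sum>(B, C)\<in>(SIGMA B:Pow X. Pow (X - B)). f B C (X - B - C))"
    by (rule sum.reindex_bij_witness[of _ "\<lambda>(B, C). (B \<union> C, B)" "\<lambda>(A, B). (B, A - B)"])
       (auto simp: Un_absorb1 intro!: arg_cong2[where f="f _"])
  also have "\<dots> = (\<Sum>B\<in>Pow X. \<Sum>C\<in>Pow (X - B). f B C (X - B - C))"
    using assms by (subst sum.Sigma) auto
  finally show ?thesis .
qed

lemma subset_conv_assoc:
  assumes "finite X"
  shows "subset_conv (subset_conv f g) h X = subset_conv f (subset_conv g h) X"
  using sum_Pow_nested[OF assms, of "\<lambda>B C D. f B * g C * h D"]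
  by (simp add: subset_conv_def sum_distrib_left sum_distrib_right mult.assoc)

lemma subset_conv_left_commute:
  assumes "finite X"
  shows "subset_conv f (subset_conv g h) X = subset_conv g (subset_conv f h) X"
proof -
  have "subset_conv f (subset_conv g h) X = subset_conv (subset_conv f g) h X"
    by (simp add: subset_conv_assoc assms)
  also have "subset_conv f g = subset_conv g f"
    by (rule ext) (rule subset_conv_commute)
  finally show ?thesis
    by (simp add: subset_conv_assoc assms)
qed

lemma subset_conv_cong:
  assumes "\<And>A. A \<subseteq> X \<Longrightarrow> f A = f' A" "\<And>A. A \<subseteq> X \<Longrightarrow> g A = g' A"
  shows "subset_conv f g X = subset_conv f' g' X"
  unfolding subset_conv_def using assms by (intro sum.cong) auto

text \<open>\<open>sum \<phi>\<close> is additive over disjoint sets, so multiplication by it obeys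
  the Leibniz rule. Later \<open>\<phi>\<close> is either the weight \<open>w\<close> or the
  indicator of a point, which marks the part containing that point.\<close>

lemma subset_conv_derivation:
  assumes "finite X"
  shows "sum \<phi> X * subset_conv f g X =
         subset_conv (\<lambda>A. sum \<phi> A * f A) g X + subset_conv f (\<lambda>A. sum \<phi> A * g A) X"
proof -
  have "sum \<phi> X = sum \<phi> A + sum \<phi> (X - A)" if "A \<in> Pow X" for A
    using that assms by (simp add: sum_diff finite_subset)
  then show ?thesis
    unfolding subset_conv_def sum_distrib_left sum.distrib[symmetric]
    by (intro sum.cong refl) (simp add: algebra_simps)
qed

lemma subset_conv_self_derivation:
  assumes "finite X"
  shows "sum \<phi> X * subset_conv f f X = 2 * subset_conv (\<lambda>A. sum \<phi> A * f A) f X"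
  using subset_conv_derivation[OF assms, of \<phi> f f] subset_conv_commute[of f "\<lambda>A. sum \<phi> A * f A" X]
  by simp

section \<open>Convolution powers and pointed subsets\<close>

text \<open>If \<open>f {} = 0\<close>, then \<open>conv_power f k X / fact k\<close> sums the
  product of \<open>f\<close> over the partitions of \<open>X\<close> into \<open>k\<close>
  unordered parts.\<close>

primrec conv_power :: "('b set \<Rightarrow> real) \<Rightarrow> nat \<Rightarrow> 'b set \<Rightarrow> real" where
  "conv_power f 0 = (\<lambda>X. if X = {} then 1 else 0)"
| "conv_power f (Suc k) = subset_conv f (conv_power f k)"

lemma subset_conv_unit:
  assumes "finite X"
  shows "subset_conv f (conv_power g 0) X = f X"
proof -
  have "subset_conv f (conv_power g 0) X = (\<Sum>A\<in>Pow X. if A = X then f A else 0)"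
    unfolding conv_power.simps subset_conv_def by (intro sum.cong) auto
  then show ?thesis
    using assms by (simp add: sum.delta)
qed

lemma conv_power_nonneg:
  assumes "\<And>A. f A \<ge> 0"
  shows "conv_power f k X \<ge> 0"
  by (induction k arbitrary: X) (auto simp: subset_conv_def intro!: sum_nonneg mult_nonneg_nonneg assms)

lemma conv_power_eq_0:
  assumes "f {} = 0" "finite X" "card X < k"
  shows "conv_power f k X = 0"
  using assms(2,3)
proof (induction k arbitrary: X)
  case (Suc k)
  have "f A * conv_power f k (X - A) = 0" if "A \<in> Pow X" for A
  proof (cases "A = {}")
    case False
    then have "card (X - A) < card X"
      using that Suc.prems by (intro psubset_card_mono) auto
    then show ?thesis
      using Suc by simp
  qed (simp add: assms)
  then show ?case
    unfolding conv_power.simps subset_conv_def by (intro sum.neutral) blast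
qed simp

text \<open>The power rule \<open>D (f^(k+1)) = (k+1) (D f) f^k\<close> for the derivation
  \<open>D\<close> given by \<open>\<phi>\<close>.\<close>

lemma conv_power_derivation:
  assumes "finite X"
  shows "sum \<phi> X * conv_power f (Suc k) X =
         real (Suc k) * subset_conv (\<lambda>A. sum \<phi> A * f A) (conv_power f k) X"
  using assms
proof (induction k arbitrary: X)
  case 0
  then show ?case
    by (simp add: subset_conv_unit del: conv_power.simps(1))
next
  case (Suc k)
  let ?Mf = "\<lambda>A. sum \<phi> A * f A"
  have "sum \<phi> X * conv_power f (Suc (Suc k)) X =
        subset_conv ?Mf (conv_power f (Suc k)) X
        + subset_conv f (\<lambda>A. sum \<phi> A * conv_power f (Suc k) A) X"
    using subset_conv_derivation[OF Suc.prems, of \<phi> f "conv_power f (Suc k)"] by simp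
  also have "subset_conv f (\<lambda>A. sum \<phi> A * conv_power f (Suc k) A) X =
             subset_conv f (\<lambda>A. real (Suc k) * subset_conv ?Mf (conv_power f k) A) X"
    using Suc.prems by (intro subset_conv_cong refl Suc.IH) (auto intro: finite_subset)
  also have "\<dots> = real (Suc k) * subset_conv f (subset_conv ?Mf (conv_power f k)) X"
    unfolding subset_conv_def[of f] sum_distrib_left by (intro sum.cong) auto
  also have "subset_conv f (subset_conv ?Mf (conv_power f k)) X = subset_conv ?Mf (conv_power f (Suc k)) X"
    using subset_conv_left_commute[OF Suc.prems, of f ?Mf "conv_power f k"] by simp
  finally show ?case
    by (simp add: algebra_simps)
qed

text \<open>In a subset with a distinguished point, the point can be chosen first and the other
  members afterwards from what remains.\<close>

lemma sum_Pow_pointed: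
  assumes "finite N"
  shows "(\<Sum>A\<in>Pow N. \<Sum>v\<in>A. f v (A - {v}) (N - A)) =
         (\<Sum>v\<in>N. \<Sum>A\<in>Pow (N - {v}). f v A (N - {v} - A))"
proof -
  have "(\<Sum>A\<in>Pow N. \<Sum>v\<in>A. f v (A - {v}) (N - A)) =
        (\<Sum>(A, v)\<in>(SIGMA A:Pow N. A). f v (A - {v}) (N - A))"
    using assms by (subst sum.Sigma) (auto intro: finite_subset)
  also have "\<dots> = (\<Sum>(v, A)\<in>(SIGMA v:N. Pow (N - {v})). f v A (N - {v} - A))"
    by (rule sum.reindex_bij_witness[of _ "\<lambda>(v, A). (insert v A, v)" "\<lambda>(A, v). (v, A - {v})"])
       (auto intro!: arg_cong2[where f="f _"])
  also have "\<dots> = (\<Sum>v\<in>N. \<Sum>A\<in>Pow (N - {v}). f v A (N - {v} - A))"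
    using assms by (subst sum.Sigma) auto
  finally show ?thesis .
qed

section \<open>Abel polynomials and Hurwitz' identities\<close>

text \<open>
  \<open>x (x + w(N))\<^bsup>|N| - 1\<^esup>\<close>, which is \<open>1\<close> for empty \<open>N\<close>; with \<open>w(N) = \<Sum>v\<in>N. w v\<close> it counts the
  weighted forests on \<open>N\<close> hung from an extra vertex of weight \<open>x\<close>, up to the factor \<open>\<Prod>v\<in>N. w v\<close>.
\<close>

definition abel :: "('b \<Rightarrow> real) \<Rightarrow> 'b set \<Rightarrow> real \<Rightarrow> real" where
  "abel w N x = (if N = {} then 1 else x * (x + sum w N) ^ (card N - 1))"

definition appell :: "('b \<Rightarrow> real) \<Rightarrow> 'b set \<Rightarrow> real \<Rightarrow> real" where
  "appell w N y = (y + sum w N) ^ card N"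

text \<open>Moving \<open>w v\<close> from the set to the argument leaves the base unchanged, so
  only the exponent drops.\<close>

lemma appell_remove:
  assumes "finite N" "v \<in> N"
  shows "appell w (N - {v}) (y + w v) = (y + sum w N) ^ (card N - 1)"
  using assms by (simp add: appell_def sum_diff1 card_Diff_singleton)

text \<open>One factor \<open>y + sum w N\<close> of the power is split into \<open>y\<close> and
  the single weights.\<close>

lemma appell_eq_abel_plus:
  assumes "finite N"
  shows "appell w N y = abel w N y + (\<Sum>v\<in>N. w v * appell w (N - {v}) (y + w v))"
proof (cases "N = {}")
  case False
  have "(\<Sum>v\<in>N. w v * appell w (N - {v}) (y + w v)) = sum w N * (y + sum w N) ^ (card N - 1)"
    unfolding sum_distrib_right by (intro sum.cong refl) (simp add: appell_remove assms)
  moreover have "appell w N y = (y + sum w N) * (y + sum w N) ^ (card N - 1)"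
    using False assms by (simp add: appell_def card_gt_0_iff flip: power_Suc)
  ultimately show ?thesis
    using False by (simp add: abel_def algebra_simps)
qed (simp add: appell_def abel_def)

text \<open>The factor \<open>card N\<close> from the power rule is spread over the vertices, one
  removed at a time, so that sums over pointed subsets apply.\<close>

lemma appell_has_derivative:
  assumes "finite N"
  shows "((\<lambda>y. appell w N y) has_real_derivative (\<Sum>v\<in>N. appell w (N - {v}) (y + w v))) (at y)"
proof -
  have "(\<Sum>v\<in>N. appell w (N - {v}) (y + w v)) = real (card N) * (y + sum w N) ^ (card N - 1)"
    by (simp add: appell_remove assms)
  then show ?thesis
    unfolding appell_def by (auto intro!: derivative_eq_intros)
qed

text \<open>
  Hurwitz' multivariate form of Abel's binomial theorem. Differentiating in \<open>y\<close> shows that the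
  defect of the first identity depends on \<open>x\<close> only; it equals the defect of the second one, which is
  symmetric in \<open>x\<close> and \<open>y\<close>, so it is constant, and it vanishes at \<open>x = 0\<close>.
\<close>

lemma hurwitz:
  assumes "finite N"
  shows "subset_conv (\<lambda>A. abel w A x) (\<lambda>A. appell w A y) N = appell w N (x + y) \<and>
         subset_conv (\<lambda>A. abel w A x) (\<lambda>A. abel w A y) N = abel w N (x + y)"
  using assms
proof (induction "card N" arbitrary: N x y rule: less_induct)
  case less
  note fin = \<open>finite N\<close>
  define E where "E x y = subset_conv (\<lambda>A. abel w A x) (\<lambda>A. appell w A y) N" for x y
  define L where "L x y = subset_conv (\<lambda>A. abel w A x) (\<lambda>A. abel w A y) N" for x y
  have IH: "(\<Sum>A\<in>Pow (N - {v}). abel w A x * appell w (N - {v} - A) y) = appell w (N - {v}) (x + y)"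
    if "v \<in> N" for v x y
  proof -
    have "card (N - {v}) < card N"
      using that fin by (intro psubset_card_mono) auto
    from less.hyps[OF this] show ?thesis
      using fin by (simp add: subset_conv_def)
  qed
  \<comment> \<open>With \<open>c = 1\<close> this evaluates the derivative of \<open>E\<close> in
    \<open>y\<close>; with \<open>c = w\<close> it gives the difference of \<open>E\<close> and
    \<open>L\<close>.\<close>
  have swap: "(\<Sum>A\<in>Pow N. \<Sum>v\<in>N - A. abel w A x * (c v * appell w (N - A - {v}) (y + w v))) =
      (\<Sum>v\<in>N. c v * appell w (N - {v}) (x + y + w v))" for c x y
  proof -
    have "(\<Sum>A\<in>Pow N. \<Sum>v\<in>N - A. abel w A x * (c v * appell w (N - A - {v}) (y + w v))) =
      (\<Sum>A\<in>Pow N. \<Sum>v\<in>A. abel w (N - A) x * (c v * appell w (A - {v}) (y + w v)))"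
      by (subst sum_Pow_complement[symmetric]) (intro sum.cong refl, auto simp: double_diff)
    also have "\<dots> = (\<Sum>v\<in>N. \<Sum>A\<in>Pow (N - {v}). abel w (N - {v} - A) x * (c v * appell w A (y + w v)))"
      by (rule sum_Pow_pointed[OF fin, of "\<lambda>v A B. abel w B x * (c v * appell w A (y + w v))"])
    also have "\<dots> = (\<Sum>v\<in>N. c v * (\<Sum>A\<in>Pow (N - {v}). abel w A x * appell w (N - {v} - A) (y + w v)))"
      by (subst sum_Pow_complement[symmetric])
         (unfold sum_distrib_left, intro sum.cong refl, auto simp: double_diff)
    finally show ?thesis
      by (simp add: IH add.assoc)
  qed
  have deriv: "((\<lambda>y. E x y - appell w N (x + y)) has_real_derivative 0) (at y)" for x y
  proof -
    have "((\<lambda>y. E x y) has_real_derivative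
        (\<Sum>A\<in>Pow N. abel w A x * (\<Sum>v\<in>N - A. appell w (N - A - {v}) (y + w v)))) (at y)"
      unfolding E_def subset_conv_def
      by (intro DERIV_sum DERIV_cmult appell_has_derivative) (use fin in auto)
    moreover have "((\<lambda>y. appell w N (x + y)) has_real_derivative
        (\<Sum>v\<in>N. appell w (N - {v}) (x + y + w v))) (at y)"
      using appell_has_derivative[OF fin, of w "y + x"]
      by (subst (asm) DERIV_shift) (simp add: add.commute)
    ultimately show ?thesis
      using swap[of x "\<lambda>_. 1" y] by (auto intro!: derivative_eq_intros simp: sum_distrib_left)
  qed
  have E_const: "E x y - appell w N (x + y) = E x z - appell w N (x + z)" for x y z
    using DERIV_const_ratio_const[of y z "\<lambda>y. E x y - appell w N (x + y)" 0] deriv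
    by (cases "y = z") auto
  have EL: "E x y - appell w N (x + y) = L x y - abel w N (x + y)" for x y
  proof -
    have "E x y = L x y + (\<Sum>v\<in>N. w v * appell w (N - {v}) (x + y + w v))"
      unfolding E_def L_def subset_conv_def swap[symmetric] sum.distrib[symmetric]
      by (intro sum.cong refl, subst appell_eq_abel_plus)
         (use fin in \<open>auto simp: distrib_left sum_distrib_left\<close>)
    then show ?thesis
      using appell_eq_abel_plus[OF fin, of w "x + y"] by simp
  qed
  have L_sym: "L x y = L y x" for x y
    unfolding L_def by (rule subset_conv_commute)
  have L_0: "L 0 y = abel w N y" for y
  proof -
    have "L 0 y = (\<Sum>A\<in>Pow N. if A = {} then abel w N y else 0)"
      unfolding L_def subset_conv_def by (intro sum.cong) (auto simp: abel_def)
    then show ?thesis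
      using fin by (simp add: sum.delta)
  qed
  have "L x y - abel w N (x + y) = 0" for x y
  proof -
    have "L x y - abel w N (x + y) = L x 0 - abel w N (x + 0)"
      using E_const[of x y 0] EL by metis
    also have "\<dots> = 0"
      using L_0[of x] L_sym[of x 0] by simp
    finally show ?thesis .
  qed
  with EL show ?case
    by (simp add: E_def L_def)
qed

lemmas hurwitz_appell = hurwitz[THEN conjunct1]
lemmas hurwitz_abel = hurwitz[THEN conjunct2]

section \<open>Weighted trees and forests with two trees\<close>

text \<open>
  The weighted Cayley count \<open>w(X)\<^bsup>|X| - 2\<^esup>\<close> of trees on \<open>X\<close> (without the factor \<open>\<Prod>v\<in>X. w v\<close>), written
  as a quotient because the exponent is \<open>-1\<close> for singletons.
\<close>

definition tree_weight :: "('b \<Rightarrow> real) \<Rightarrow> 'b set \<Rightarrow> real" where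
  "tree_weight w X = (if X = {} then 0 else sum w X ^ card X / (sum w X)\<^sup>2)"

text \<open>Singletons need no separate case: for \<open>card N = 1\<close> the factor
  \<open>real (card N - 1)\<close> is \<open>0\<close>, so the truncated exponent does no
  harm.\<close>

lemma abel_has_derivative:
  "((\<lambda>x. abel w N x) has_real_derivative
     (if N = {} then 0
      else (x + sum w N) ^ (card N - 1) + x * (real (card N - 1) * (x + sum w N) ^ (card N - 2)))) (at x)"
  unfolding abel_def by (cases "N = {}") (auto intro!: derivative_eq_intros simp: numeral_2_eq_2)

lemma abel_has_second_derivative:
  "((\<lambda>x. if N = {} then 0
      else (x + sum w N) ^ (card N - 1) + x * (real (card N - 1) * (x + sum w N) ^ (card N - 2)))
    has_real_derivative
     (if N = {} then 0
      else 2 * (real (card N - 1) * (x + sum w N) ^ (card N - 2))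
           + x * (real (card N - 1) * (real (card N - 2) * (x + sum w N) ^ (card N - 3))))) (at x)"
  by (cases "N = {}") (auto intro!: derivative_eq_intros simp: numeral_2_eq_2 numeral_3_eq_3)

text \<open>
  A tree has one more vertex than edges. Both terms are coefficients of Abel polynomials: the second
  one is half the second derivative of \<open>abel w B\<close> at \<open>0\<close>, so Hurwitz' identity applies to each.
\<close>

lemma tree_weight_eq_vertices_minus_edges:
  fixes w :: "'b \<Rightarrow> real"
  assumes "finite B" "\<And>v. v \<in> B \<Longrightarrow> w v > 0"
  shows "tree_weight w B =
    (\<Sum>s\<in>B. abel w (B - {s}) (w s) / w s)
    - (if B = {} then 0 else real (card B - 1) * sum w B ^ (card B - 2))"
proof (cases "B = {}")
  case False
  have pos: "sum w B > 0"
    using assms False by (intro sum_pos) auto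
  show ?thesis
  proof (cases "card B = 1")
    case True
    then obtain s where "B = {s}"
      by (auto simp: card_1_singleton_iff)
    then show ?thesis
      using assms by (simp add: tree_weight_def abel_def power2_eq_square)
  next
    case ne: False
    then have c: "card B \<ge> 2"
      using False assms by (metis One_nat_def Suc_1 Suc_leI card_gt_0_iff le_neq_implies_less)
    \<comment> \<open>Every vertex contributes the same amount, so the difference is
      \<open>card B - (card B - 1)\<close> times it.\<close>
    have "abel w (B - {s}) (w s) / w s = sum w B ^ (card B - 2)" if "s \<in> B" for s
    proof -
      have "B - {s} \<noteq> {}"
        using c that by (metis card_Diff_singleton card.empty diff_is_0_eq not_one_le_zero ne
            Suc_1 Suc_leI le_antisym less_eq_Suc_le One_nat_def card_gt_0_iff assms(1) False)
      then show ?thesis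
        using assms that by (simp add: abel_def sum_diff1 card_Diff_singleton numeral_2_eq_2)
          (metis less_irrefl)
    qed
    moreover have "tree_weight w B = sum w B ^ (card B - 2)"
      using pos c False by (simp add: tree_weight_def power_diff)
    ultimately show ?thesis
      using c False by (simp add: of_nat_diff algebra_simps)
  qed
qed (simp add: tree_weight_def)

text \<open>By symmetry the left side is \<open>sum w X / 2\<close> times the convolution square of
  \<open>tree_weight w\<close>. A root \<open>r\<close> distinguishes one of the two trees; the
  weight of that tree becomes an Abel polynomial, and Hurwitz' identities evaluate the sum over the
  other tree.\<close>

lemma two_tree_forests:
  fixes w :: "'b \<Rightarrow> real"
  assumes fin: "finite X" and pos: "\<And>v. v \<in> X \<Longrightarrow> w v > 0" and ne: "X \<noteq> {}"
  shows "subset_conv (\<lambda>A. sum w A * tree_weight w A) (tree_weight w) X =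
    tree_weight w X * ((\<Sum>v\<in>X. 1 / w v) - (real (card X) - 2) * (real (card X) - 3) / (2 * sum w X))"
proof -
  obtain r where r: "r \<in> X"
    using ne by blast
  define N where "N = X - {r}"
  define y where "y = w r"
  define S where "S = sum w X"
  define m where "m = card N"
  have finN: "finite N" and posN: "\<And>v. v \<in> N \<Longrightarrow> w v > 0" and ypos: "y > 0"
    using fin pos r by (auto simp: N_def y_def)
  have cX: "card X = Suc m"
    unfolding N_def m_def by (rule card.remove[OF fin r])
  have SN: "y + sum w N = S"
    using fin r by (simp add: N_def S_def y_def sum_diff1)
  have Spos: "S > 0"
    unfolding S_def using assms by (intro sum_pos) auto
  \<comment> \<open>Here \<open>B\<close> carries the tree that avoids \<open>r\<close>; the weight
    of the tree through \<open>r\<close> enters multiplied by \<open>y\<close>.\<close>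
  define q where "q = (\<Sum>B\<in>Pow N. tree_weight w B * abel w (N - B) y)"
  \<comment> \<open>Twice the edge term is the second derivative of \<open>abel w B\<close> at
    \<open>0\<close>, so Hurwitz' identity is differentiated twice in \<open>x\<close>.\<close>
  have second: "(\<Sum>B\<in>Pow N. (if B = {} then 0 else real (card B - 1) * sum w B ^ (card B - 2)) * abel w (N - B) y)
     = (if N = {} then 0 else real (m - 1) * S ^ (m - 2) + y * (real (m - 1) * (real (m - 2) * S ^ (m - 3))) / 2)"
    (is "?L = ?R")
  proof -
    define h1 where "h1 = (\<lambda>N x. if N = {} then 0
      else (x + sum w N) ^ (card N - 1) + x * (real (card N - 1) * (x + sum w N) ^ (card N - 2)))"
    define h2 where "h2 = (\<lambda>N x. if N = {} then 0
      else 2 * (real (card N - 1) * (x + sum w N) ^ (card N - 2))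
           + x * (real (card N - 1) * (real (card N - 2) * (x + sum w N) ^ (card N - 3))))"
    have d1: "((\<lambda>x. abel w B x) has_real_derivative h1 B x) (at x)" for B x
      unfolding h1_def by (rule abel_has_derivative)
    have d2: "((\<lambda>x. h1 B x) has_real_derivative h2 B x) (at x)" for B x
      unfolding h1_def h2_def by (rule abel_has_second_derivative)
    have eq0: "(\<Sum>B\<in>Pow N. abel w B x * abel w (N - B) y) = abel w N (x + y)" for x
      using hurwitz_abel[OF finN, of w x y] by (simp add: subset_conv_def)
    have eq1: "(\<Sum>B\<in>Pow N. h1 B x * abel w (N - B) y) = h1 N (x + y)" for x
    proof -
      have "((\<lambda>x. \<Sum>B\<in>Pow N. abel w B x * abel w (N - B) y) has_real_derivative
             (\<Sum>B\<in>Pow N. h1 B x * abel w (N - B) y)) (at x)"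
        by (intro DERIV_sum DERIV_cmult_right d1)
      moreover have "((\<lambda>x. abel w N (x + y)) has_real_derivative h1 N (x + y)) (at x)"
        using d1[of N "x + y"] by (simp add: DERIV_shift)
      ultimately show ?thesis
        unfolding eq0 by (rule DERIV_unique)
    qed
    have eq2: "(\<Sum>B\<in>Pow N. h2 B x * abel w (N - B) y) = h2 N (x + y)" for x
    proof -
      have "((\<lambda>x. \<Sum>B\<in>Pow N. h1 B x * abel w (N - B) y) has_real_derivative
             (\<Sum>B\<in>Pow N. h2 B x * abel w (N - B) y)) (at x)"
        by (intro DERIV_sum DERIV_cmult_right d2)
      moreover have "((\<lambda>x. h1 N (x + y)) has_real_derivative h2 N (x + y)) (at x)"
        using d2[of N "x + y"] by (simp add: DERIV_shift)
      ultimately show ?thesis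
        unfolding eq1 by (rule DERIV_unique)
    qed
    have "2 * ?L = (\<Sum>B\<in>Pow N. h2 B 0 * abel w (N - B) y)"
      unfolding sum_distrib_left h2_def by (intro sum.cong) auto
    also have "\<dots> = h2 N y"
      using eq2[of 0] by simp
    also have "\<dots> = 2 * ?R"
      by (simp add: h2_def SN m_def)
    finally show ?thesis
      by simp
  qed
  \<comment> \<open>Choosing \<open>s\<close> first reduces each summand to Hurwitz' identity on
    \<open>N - {s}\<close> with arguments \<open>w s\<close> and \<open>y\<close>.\<close>
  have first: "(\<Sum>B\<in>Pow N. (\<Sum>s\<in>B. abel w (B - {s}) (w s) / w s) * abel w (N - B) y) =
     (\<Sum>s\<in>N. abel w (N - {s}) (w s + y) / w s)"
  proof -
    have "(\<Sum>B\<in>Pow N. (\<Sum>s\<in>B. abel w (B - {s}) (w s) / w s) * abel w (N - B) y) =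
        (\<Sum>B\<in>Pow N. \<Sum>s\<in>B. abel w (B - {s}) (w s) / w s * abel w (N - B) y)"
      by (simp add: sum_distrib_right)
    also have "\<dots> = (\<Sum>s\<in>N. \<Sum>A\<in>Pow (N - {s}). abel w A (w s) / w s * abel w (N - {s} - A) y)"
      by (rule sum_Pow_pointed[OF finN])
    also have "\<dots> = (\<Sum>s\<in>N. subset_conv (\<lambda>A. abel w A (w s)) (\<lambda>A. abel w A y) (N - {s}) / w s)"
      by (simp add: subset_conv_def sum_divide_distrib)
    finally show ?thesis
      using finN by (simp add: hurwitz_abel)
  qed
  have "q = (\<Sum>s\<in>N. abel w (N - {s}) (w s + y) / w s)
      - (if N = {} then 0 else real (m - 1) * S ^ (m - 2) + y * (real (m - 1) * (real (m - 2) * S ^ (m - 3))) / 2)"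
    unfolding q_def first[symmetric] second[symmetric] sum_subtractf[symmetric]
    by (intro sum.cong refl, subst tree_weight_eq_vertices_minus_edges)
       (use finN posN in \<open>auto simp: left_diff_distrib intro: finite_subset\<close>)
  also have "(\<Sum>s\<in>N. abel w (N - {s}) (w s + y) / w s) = (\<Sum>s\<in>N. (1 + y / w s) * (S ^ m / S\<^sup>2))"
  proof (intro sum.cong refl)
    fix s assume s: "s \<in> N"
    have "abel w (N - {s}) (w s + y) = (w s + y) * (S ^ m / S\<^sup>2)"
    proof (cases "N = {s}")
      case True
      then show ?thesis
        using SN Spos by (simp add: abel_def m_def power2_eq_square add.commute)
    next
      case False
      then have ne': "N - {s} \<noteq> {}"
        using s by blast
      then have "card (N - {s}) \<ge> 1"
        using finN by (simp add: Suc_leI card_gt_0_iff)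
      then have "m \<ge> 2"
        using s finN by (simp add: m_def card_Diff_singleton)
      moreover have "w s + y + sum w (N - {s}) = S"
        using s finN SN by (simp add: sum_diff1)
      ultimately show ?thesis
        using ne' s finN Spos by (simp add: abel_def m_def card_Diff_singleton power_diff numeral_2_eq_2)
    qed
    then show "abel w (N - {s}) (w s + y) / w s = (1 + y / w s) * (S ^ m / S\<^sup>2)"
      using posN[OF s] by (simp add: field_simps)
  qed
  also have "\<dots> = (real m + y * (\<Sum>s\<in>N. 1 / w s)) * (S ^ m / S\<^sup>2)"
    unfolding sum_distrib_right[symmetric] by (simp add: sum.distrib sum_distrib_left m_def)
  also have "(if N = {} then 0 else real (m - 1) * S ^ (m - 2) + y * (real (m - 1) * (real (m - 2) * S ^ (m - 3))) / 2)
     = (if N = {} then 0 else (real m - 1) + y * (real m - 1) * (real m - 2) / (2 * S)) * (S ^ m / S\<^sup>2)"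
  proof (cases "N = {}")
    case False
    then have "m \<ge> 1"
      using finN by (simp add: m_def Suc_leI card_gt_0_iff)
    \<comment> \<open>The exponents \<open>m - 2\<close> and \<open>m - 3\<close> are truncated, so
      the two smallest values of \<open>m\<close> are treated apart.\<close>
    then consider "m = 1" | "m = 2" | k where "m = k + 3"
      by (metis One_nat_def Suc_1 add.commute le_Suc_ex numeral_3_eq_3 not_less_eq_eq le_antisym)
    then show ?thesis
    proof cases
      case 3
      then show ?thesis
        using False Spos by (simp add: field_simps power_add power2_eq_square power3_eq_cube)
    qed (use False Spos in \<open>simp_all add: power2_eq_square\<close>)
  qed simp
  finally have q: "q = (real m + y * (\<Sum>s\<in>N. 1 / w s)) * (S ^ m / S\<^sup>2) -
    (if N = {} then 0 else (real m - 1) + y * (real m - 1) * (real m - 2) / (2 * S)) * (S ^ m / S\<^sup>2)" .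
  have inv: "(\<Sum>v\<in>X. 1 / w v) = 1 / y + (\<Sum>s\<in>N. 1 / w s)"
    unfolding N_def y_def by (rule sum.remove[OF fin r])
  have tX: "tree_weight w X = S * (S ^ m / S\<^sup>2)"
    using ne by (simp add: tree_weight_def S_def cX)
  have q': "S * q = y * (tree_weight w X * ((\<Sum>v\<in>X. 1 / w v)
      - (real (card X) - 2) * (real (card X) - 3) / (2 * S)))"
  proof (cases "N = {}")
    case True
    then have "m = 0" "S = y"
      using SN by (auto simp: m_def)
    then show ?thesis
      using True ypos unfolding q inv tX cX by (simp add: field_simps)
  next
    case False
    show ?thesis
      using False ypos Spos unfolding q inv tX cX
      by (simp add: field_simps)
  qed
  \<comment> \<open>The derivation is taken at the indicator of \<open>r\<close>: each unordered
    pair of trees is counted twice, and exactly one of the two avoids \<open>r\<close>.\<close>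
  have root: "subset_conv (tree_weight w) (tree_weight w) X * y = 2 * q"
  proof -
    have "subset_conv (tree_weight w) (tree_weight w) X =
        2 * subset_conv (\<lambda>A. (\<Sum>a\<in>A. if a = r then 1 else 0) * tree_weight w A) (tree_weight w) X"
      using subset_conv_self_derivation[OF fin, of "\<lambda>a. if a = r then 1 else 0" "tree_weight w"] fin r
      by simp
    also have "subset_conv (\<lambda>A. (\<Sum>a\<in>A. if a = r then 1 else 0) * tree_weight w A) (tree_weight w) X
       = subset_conv (tree_weight w) (\<lambda>A. (\<Sum>a\<in>A. if a = r then 1 else 0) * tree_weight w A) X"
      by (rule subset_conv_commute)
    also have "\<dots> = (\<Sum>B\<in>Pow X. if r \<in> B then 0 else tree_weight w B * tree_weight w (X - B))"
      unfolding subset_conv_def using fin r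
      by (intro sum.cong refl) (auto simp: sum.delta)
    also have "\<dots> = (\<Sum>B\<in>Pow N. tree_weight w B * tree_weight w (X - B))"
      using fin by (intro sum.mono_neutral_cong_right) (auto simp: N_def)
    finally have "subset_conv (tree_weight w) (tree_weight w) X =
       2 * (\<Sum>B\<in>Pow N. tree_weight w B * tree_weight w (X - B))" .
    moreover have "tree_weight w (X - B) * y = abel w (N - B) y" if "B \<in> Pow N" for B
    proof -
      have XB: "X - B = insert r (N - B)" and rN: "r \<notin> N - B" and fNB: "finite (N - B)"
        using that r finN by (auto simp: N_def)
      show ?thesis
      proof (cases "N - B = {}")
        case True
        then have "X - B = {r}" "N - B = {}"
          using XB by auto
        then show ?thesis
          using ypos by (simp add: tree_weight_def abel_def y_def power2_eq_square)
      next
        case False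
        have "sum w (N - B) > 0"
          using False finN posN by (intro sum_pos) auto
        then have "y + sum w (N - B) > 0"
          using ypos by simp
        moreover have "card (X - B) = Suc (card (N - B))" "sum w (X - B) = y + sum w (N - B)" "X - B \<noteq> {}"
          using XB rN fNB by (simp_all add: y_def)
        moreover have "card (N - B) = Suc (card (N - B) - 1)"
          using False fNB by (simp add: card_gt_0_iff)
        then have "(y + sum w (N - B)) ^ card (N - B) =
            (y + sum w (N - B)) * (y + sum w (N - B)) ^ (card (N - B) - 1)"
          by (metis power_Suc)
        ultimately show ?thesis
          using False by (simp add: tree_weight_def abel_def power2_eq_square)
      qed
    qed
    ultimately show ?thesis
      unfolding q_def by (auto simp: sum_distrib_left sum_distrib_right mult.assoc intro!: sum.cong)
  qed
  have cancel: "y * U = S * q" if "2 * U = S * T" "T * y = 2 * q" for U T :: real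
    using that by algebra
  have "2 * subset_conv (\<lambda>A. sum w A * tree_weight w A) (tree_weight w) X =
      S * subset_conv (tree_weight w) (tree_weight w) X"
    using subset_conv_self_derivation[OF fin, of w "tree_weight w"] by (simp add: S_def)
  then have "y * subset_conv (\<lambda>A. sum w A * tree_weight w A) (tree_weight w) X = S * q"
    using root cancel by blast
  with q' ypos show ?thesis
    by (simp add: S_def)
qed

lemma two_tree_forests_le:
  fixes w :: "'b \<Rightarrow> real"
  assumes fin: "finite X" and ge1: "\<And>v. v \<in> X \<Longrightarrow> w v \<ge> 1"
  shows "subset_conv (\<lambda>A. sum w A * tree_weight w A) (tree_weight w) X \<le>
    tree_weight w X * (sum w X / 2 + 5 / 2)"
proof (cases "X = {}")
  case False
  define S n where "S = sum w X" and "n = real (card X)"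
  have nS: "n \<le> S"
    using sum_mono[of X "\<lambda>_. 1" w] ge1 by (simp add: S_def n_def)
  have "n > 0"
    using False fin by (simp add: n_def card_gt_0_iff)
  with nS have Spos: "S > 0"
    by simp
  have inv: "(\<Sum>v\<in>X. 1 / w v) \<le> n"
    using sum_mono[of X "\<lambda>v. 1 / w v" "\<lambda>_. 1"] ge1 by (force simp: n_def)
  have "n - (n - 2) * (n - 3) / (2 * S) \<le> S / 2 + 5 / 2"
  proof -
    \<comment> \<open>After multiplication by \<open>2 * S\<close> this is exactly the required
      inequality; the constant \<open>5 / 2\<close> makes the linear terms combine to
      \<open>5 * (S - n)\<close>.\<close>
    have "0 \<le> (S - n)\<^sup>2 + 5 * (S - n) + 6"
      using nS by simp
    then show ?thesis
      using Spos by (simp add: field_simps power2_eq_square)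
  qed
  with inv have "(\<Sum>v\<in>X. 1 / w v) - (n - 2) * (n - 3) / (2 * S) \<le> S / 2 + 5 / 2"
    by linarith
  moreover have "tree_weight w X \<ge> 0"
    using Spos by (simp add: tree_weight_def S_def)
  moreover have "w v > 0" if "v \<in> X" for v
    using ge1[OF that] by simp
  ultimately show ?thesis
    using two_tree_forests[OF fin _ False, of w] by (simp add: mult_left_mono n_def S_def)
qed (simp add: subset_conv_def tree_weight_def)

section \<open>Weights of forests by number of trees\<close>

lemma tree_weight_nonneg:
  assumes "\<And>v. w v \<ge> 0"
  shows "tree_weight w X \<ge> 0"
  using assms by (simp add: tree_weight_def sum_nonneg)

text \<open>The derivation isolates a pair of trees on a common vertex set \<open>A\<close>, and
  \<open>two_tree_forests_le\<close> replaces the pair by one tree. Its term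
  \<open>sum w A / 2\<close> reassembles to \<open>sum w X\<close> and yields
  \<open>1 / (2 * Suc k)\<close>; its constant \<open>5 / 2\<close> is left with the factor
  \<open>1 / sum w X\<close>.\<close>

lemma forest_weight_step:
  fixes w :: "'b \<Rightarrow> real"
  assumes fin: "finite X" "X \<noteq> {}" and ge0: "\<And>v. w v \<ge> 0" and ge1: "\<And>v. v \<in> X \<Longrightarrow> w v \<ge> 1"
  shows "conv_power (tree_weight w) (Suc (Suc k)) X / fact (Suc (Suc k)) \<le>
    conv_power (tree_weight w) (Suc k) X / fact (Suc k) * (1 / (2 * real (Suc k)) + 5 / (2 * sum w X))"
proof -
  let ?t = "tree_weight w"
  let ?p = "conv_power ?t"
  let ?u = "\<lambda>A. sum w A * ?t A"
  have t0: "?t A \<ge> 0" for A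
    by (rule tree_weight_nonneg) (rule ge0)
  have W: "sum w X > 0"
    using fin ge1 by (intro sum_pos) (auto intro: less_le_trans[OF zero_less_one])
  have "sum w X * ?p (Suc (Suc k)) X = real (Suc (Suc k)) * subset_conv ?u (?p (Suc k)) X"
    by (rule conv_power_derivation[OF fin(1)])
  also have "subset_conv ?u (?p (Suc k)) X = subset_conv (subset_conv ?u ?t) (?p k) X"
    using subset_conv_assoc[OF fin(1), of ?u ?t "?p k"] by simp
  also have "\<dots> \<le> subset_conv (\<lambda>A. ?t A * (sum w A / 2 + 5 / 2)) (?p k) X"
    unfolding subset_conv_def[of _ "?p k"]
    using fin ge1 by (intro sum_mono mult_right_mono two_tree_forests_le conv_power_nonneg t0)
                     (auto intro: finite_subset)
  also have "\<dots> = 1 / 2 * subset_conv ?u (?p k) X + 5 / 2 * ?p (Suc k) X"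
    unfolding subset_conv_def conv_power.simps sum_distrib_left sum.distrib[symmetric]
    by (intro sum.cong) (auto simp: algebra_simps)
  \<comment> \<open>The derivation rule again, now read from right to left.\<close>
  also have "subset_conv ?u (?p k) X = sum w X * ?p (Suc k) X / real (Suc k)"
    using conv_power_derivation[OF fin(1), of w ?t k] by (simp add: field_simps)
  finally have le: "sum w X * ?p (Suc (Suc k)) X \<le>
      real (Suc (Suc k)) * (1 / 2 * (sum w X * ?p (Suc k) X / real (Suc k)) + 5 / 2 * ?p (Suc k) X)"
    by (simp del: conv_power.simps of_nat_Suc)
  define P Q c where "P = ?p (Suc (Suc k)) X" and "Q = ?p (Suc k) X" and "c = (fact (Suc k) :: real)"
  have c: "c > 0" "fact (Suc (Suc k)) = real (Suc (Suc k)) * c"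
    unfolding c_def by (rule fact_gt_zero, rule fact_Suc)
  have "P \<le> real (Suc (Suc k)) * (Q * (1 / (2 * real (Suc k)) + 5 / (2 * sum w X)))"
  proof -
    have "sum w X * P \<le> sum w X * (real (Suc (Suc k)) * (Q * (1 / (2 * real (Suc k)) + 5 / (2 * sum w X))))"
      using le W unfolding P_def[symmetric] Q_def[symmetric] by (simp add: algebra_simps del: of_nat_Suc)
    with W show ?thesis
      by simp
  qed
  then show ?thesis
    unfolding P_def[symmetric] Q_def[symmetric] c_def[symmetric] c(2)
    using c(1) by (simp add: field_simps del: of_nat_Suc)
qed

lemma forest_weight_le:
  fixes w :: "'b \<Rightarrow> real"
  assumes "finite X" "X \<noteq> {}" "\<And>v. w v \<ge> 0" "\<And>v. v \<in> X \<Longrightarrow> w v \<ge> 1"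
  shows "conv_power (tree_weight w) (Suc k) X / fact (Suc k) \<le>
    tree_weight w X * (\<Prod>i=1..k. 1 / (2 * real i) + 5 / (2 * sum w X))"
proof (induction k)
  case 0
  then show ?case
    using assms by (simp add: subset_conv_unit del: conv_power.simps(1))
next
  case (Suc k)
  have "sum w X \<ge> 0"
    using assms(3) by (intro sum_nonneg)
  then have "1 / (2 * real (Suc k)) + 5 / (2 * sum w X) \<ge> 0"
    by simp
  from mult_right_mono[OF Suc.IH this] have "conv_power (tree_weight w) (Suc k) X / fact (Suc k)
      * (1 / (2 * real (Suc k)) + 5 / (2 * sum w X)) \<le>
      tree_weight w X * (\<Prod>i=1..Suc k. 1 / (2 * real i) + 5 / (2 * sum w X))"
    by (simp add: mult.assoc del: conv_power.simps fact_Suc of_nat_Suc)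
  then show ?case
    using order_trans[OF forest_weight_step[OF assms(1,2), of w k]] assms(3,4) by blast
qed

text \<open>The derivation is taken at the indicator of \<open>r\<close>: exactly one of the
  \<open>Suc k\<close> parts contains \<open>r\<close>, and the factor \<open>Suc k\<close> reduces
  \<open>fact (Suc k)\<close> to \<open>fact k\<close>.\<close>

lemma conv_power_root:
  assumes "finite X" "r \<in> X"
  shows "conv_power f (Suc k) X / fact (Suc k) =
    (\<Sum>A\<in>{A. r \<in> A \<and> A \<subseteq> X}. f A * (conv_power f k (X - A) / fact k))"
proof -
  have "conv_power f (Suc k) X =
      real (Suc k) * subset_conv (\<lambda>A. (\<Sum>a\<in>A. if a = r then 1 else 0) * f A) (conv_power f k) X"
    using conv_power_derivation[OF assms(1), of "\<lambda>a. if a = r then 1 else 0" f k] assms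
    by (simp del: conv_power.simps)
  also have "subset_conv (\<lambda>A. (\<Sum>a\<in>A. if a = r then 1 else 0) * f A) (conv_power f k) X =
      (\<Sum>A\<in>Pow X. if r \<in> A then f A * conv_power f k (X - A) else 0)"
    unfolding subset_conv_def using assms
    by (intro sum.cong refl) (auto simp: sum.delta finite_subset)
  also have "\<dots> = (\<Sum>A\<in>{A. r \<in> A \<and> A \<subseteq> X}. f A * conv_power f k (X - A))"
    using assms by (intro sum.mono_neutral_cong_right) auto
  finally show ?thesis
    by (simp add: sum_divide_distrib del: conv_power.simps of_nat_Suc)
qed

text \<open>The algebraic counterpart of cutting a tree at one of its \<open>card X - 1\<close>
  edges, taken with two orientations, into two rooted trees. It comes from differentiating the first
  Hurwitz identity at \<open>x = 0\<close>, with \<open>y = 0\<close>.\<close>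

lemma conv_rooted_tree_weight:
  fixes w :: "'b \<Rightarrow> real"
  assumes fin: "finite X" and ne: "X \<noteq> {}" and pos: "\<And>v. v \<in> X \<Longrightarrow> w v > 0"
  shows "subset_conv (\<lambda>A. sum w A * tree_weight w A) (\<lambda>A. sum w A * tree_weight w A) X =
    2 * (real (card X) - 1) * tree_weight w X"
proof -
  let ?u = "\<lambda>A. sum w A * tree_weight w A"
  define S where "S = sum w X"
  have Spos: "S > 0"
    unfolding S_def using assms by (intro sum_pos) auto
  have u: "?u A = (if A = {} then 0 else sum w A ^ (card A - 1))" if "A \<subseteq> X" for A
  proof (cases "A = {}")
    case False
    then have "sum w A > 0"
      using that fin pos by (intro sum_pos) (auto intro: finite_subset)
    moreover have "card A > 0"
      using that fin False by (auto simp: card_gt_0_iff intro: finite_subset)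
    ultimately show ?thesis
      using False by (simp add: tree_weight_def power2_eq_square power_eq_if[of _ "card A"])
  qed simp
  have d: "(\<Sum>A\<in>Pow X. ?u A * appell w (X - A) 0) = real (card X) * S ^ (card X - 1)"
  proof -
    have "((\<lambda>x. \<Sum>A\<in>Pow X. abel w A x * appell w (X - A) 0) has_real_derivative
       (\<Sum>A\<in>Pow X. ?u A * appell w (X - A) 0)) (at 0)"
    proof (intro DERIV_sum DERIV_cmult_right)
      fix A assume "A \<in> Pow X"
      then show "((\<lambda>x. abel w A x) has_real_derivative ?u A) (at 0)"
        using abel_has_derivative[of w A 0] u[of A] by (auto split: if_splits)
    qed
    moreover have "((\<lambda>x. appell w X x) has_real_derivative real (card X) * S ^ (card X - 1)) (at 0)"
      unfolding appell_def S_def by (auto intro!: derivative_eq_intros)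
    moreover have "(\<lambda>x. \<Sum>A\<in>Pow X. abel w A x * appell w (X - A) 0) = appell w X"
      using hurwitz_appell[OF fin, of w _ 0] by (auto simp: subset_conv_def)
    ultimately show ?thesis
      by (metis DERIV_unique)
  qed
  \<comment> \<open>For \<open>A = X\<close> the factor \<open>appell w {} 0\<close> is
    \<open>1\<close>, while \<open>sum w {}\<close> vanishes; the extra term accounts for
    this.\<close>
  have "(\<Sum>A\<in>Pow X. ?u A * appell w (X - A) 0) =
      (\<Sum>A\<in>Pow X. ?u A * (sum w (X - A) * ?u (X - A)) + (if A = X then ?u X else 0))"
  proof (intro sum.cong refl)
    fix A assume A: "A \<in> Pow X"
    show "?u A * appell w (X - A) 0 =
      ?u A * (sum w (X - A) * ?u (X - A)) + (if A = X then ?u X else 0)"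
    proof (cases "A = X")
      case False
      then have "card (X - A) > 0" "X - A \<noteq> {}"
        using A fin by (auto simp: card_gt_0_iff)
      then show ?thesis
        using False u[of "X - A"] by (auto simp: appell_def power_eq_if[of _ "card (X - A)"])
    qed (simp add: appell_def)
  qed
  also have "\<dots> = subset_conv ?u (\<lambda>A. sum w A * ?u A) X + ?u X"
    using fin by (simp add: sum.distrib subset_conv_def sum.delta)
  finally have "subset_conv ?u (\<lambda>A. sum w A * ?u A) X = (real (card X) - 1) * ?u X"
    using d u[of X] ne by (simp add: S_def algebra_simps)
  moreover have "S * subset_conv ?u ?u X = 2 * subset_conv ?u (\<lambda>A. sum w A * ?u A) X"
    using subset_conv_self_derivation[OF fin, of w ?u]
      subset_conv_commute[of ?u "\<lambda>A. sum w A * ?u A" X] by (simp add: S_def)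
  ultimately have "S * subset_conv ?u ?u X = S * (2 * (real (card X) - 1) * tree_weight w X)"
    by (simp add: S_def algebra_simps)
  with Spos show ?thesis
    by simp
qed

section \<open>Forests over a fixed graph\<close>

abbreviation con :: "'a set set \<Rightarrow> ('a \<times> 'a) set" where
  "con E \<equiv> (adj_rel E)\<^sup>*"

lemma con_sym: "(u, v) \<in> con E \<Longrightarrow> (v, u) \<in> con E"
proof -
  have "sym (adj_rel E)"
    by (auto simp: sym_def adj_rel_def insert_commute)
  then show "(u, v) \<in> con E \<Longrightarrow> (v, u) \<in> con E"
    using sym_rtrancl symD by metis
qed

lemma con_mono: "E \<subseteq> E' \<Longrightarrow> (u, v) \<in> con E \<Longrightarrow> (u, v) \<in> con E'"
  using rtrancl_mono[of "adj_rel E" "adj_rel E'"] by (auto simp: adj_rel_def)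

lemma con_edge: "{u, v} \<in> E \<Longrightarrow> (u, v) \<in> con E"
  by (auto simp: adj_rel_def)

text \<open>A walk can be shortened until it crosses the added edge at most once.\<close>

lemma con_insertD:
  assumes "(x, y) \<in> con (insert {u, v} E)"
  shows "(x, y) \<in> con E \<or> (x, u) \<in> con E \<and> (v, y) \<in> con E \<or> (x, v) \<in> con E \<and> (u, y) \<in> con E"
  using assms
proof (induction rule: rtrancl_induct)
  case (step y z)
  then consider "{y, z} \<in> E" | "y = u" "z = v" | "y = v" "z = u"
    by (auto simp: adj_rel_def doubleton_eq_iff)
  then show ?case
  proof cases
    case 1
    then have "(a, z) \<in> con E" if "(a, y) \<in> con E" for a
      using that con_edge rtrancl_trans by metis
    with step.IH show ?thesis
      by blast
  qed (use step.IH in auto)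
qed simp

text \<open>\<open>X\<close> is closed under the edges meeting it, so a walk from inside never
  leaves it and uses only edges of \<open>E'\<close>.\<close>

lemma con_local:
  assumes "(x, y) \<in> con E" "x \<in> X" "\<And>e. e \<in> E \<Longrightarrow> e \<inter> X \<noteq> {} \<Longrightarrow> e \<subseteq> X \<and> e \<in> E'"
  shows "(x, y) \<in> con E' \<and> y \<in> X"
  using assms(1)
proof (induction rule: rtrancl_induct)
  case (step y z)
  then have "{y, z} \<in> E"
    by (simp add: adj_rel_def)
  with step.IH assms(3)[of "{y, z}"] have "{y, z} \<in> E'" "z \<in> X"
    by auto
  with step.IH show ?case
    by (meson con_edge rtrancl_trans)
qed (simp add: assms)

lemma edge_elem:
  assumes "F \<in> graphs_on X" "e \<in> F"
  obtains u v where "e = {u, v}" "u \<noteq> v" "u \<in> X" "v \<in> X"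
proof -
  have "e \<subseteq> X" "card e = 2"
    using assms by (auto simp: graphs_on_def)
  then show ?thesis
    using that by (auto simp: card_2_iff)
qed

lemma finite_graphs_on: "finite X \<Longrightarrow> finite (graphs_on X)"
  by (simp add: graphs_on_def)

text \<open>Every edge of \<open>F\<close> is a bridge of \<open>G \<union> F\<close>, expressed by
  reachability; for graphs this means that \<open>F\<close> is a forest once the components of
  \<open>G\<close> are contracted. In particular no edge of \<open>G\<close> can belong to
  \<open>F\<close>.\<close>

definition forest_over :: "'a set set \<Rightarrow> 'a set set \<Rightarrow> bool" where
  "forest_over G F \<longleftrightarrow> (\<forall>u v. {u, v} \<in> F \<longrightarrow> (u, v) \<notin> con (G \<union> (F - {{u, v}})))"

lemma forest_over_subset: "forest_over G F \<Longrightarrow> F' \<subseteq> F \<Longrightarrow> forest_over G F'"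
  unfolding forest_over_def
proof (intro allI impI notI)
  fix u v assume F: "\<forall>u v. {u, v} \<in> F \<longrightarrow> (u, v) \<notin> con (G \<union> (F - {{u, v}}))" "F' \<subseteq> F"
    and uv: "{u, v} \<in> F'" "(u, v) \<in> con (G \<union> (F' - {{u, v}}))"
  have "(u, v) \<in> con (G \<union> (F - {{u, v}}))"
    using uv(2) by (rule con_mono[rotated]) (use F(2) in blast)
  then show False
    using F uv(1) by blast
qed

text \<open>If an old edge \<open>{x, y}\<close> stopped separating its ends, the detour would pass
  through \<open>{u, v}\<close>; together with \<open>{x, y}\<close> itself it would connect
  \<open>u\<close> and \<open>v\<close> within \<open>G \<union> F\<close>.\<close>

lemma forest_over_insert:
  assumes "forest_over G F" "(u, v) \<notin> con (G \<union> F)"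
  shows "forest_over G (insert {u, v} F)"
  unfolding forest_over_def
proof (intro allI impI notI)
  fix x y assume e: "{x, y} \<in> insert {u, v} F" and c: "(x, y) \<in> con (G \<union> (insert {u, v} F - {{x, y}}))"
  show False
  proof (cases "{x, y} = {u, v}")
    case True
    have "(x, y) \<in> con (G \<union> F)"
      using c by (rule con_mono[rotated]) (use True in auto)
    with True assms(2) show False
      using con_sym by (metis doubleton_eq_iff)
  next
    case False
    then have F: "{x, y} \<in> F"
      using e by simp
    have "(x, y) \<in> con (insert {u, v} (G \<union> (F - {{x, y}})))"
      using c by (rule con_mono[rotated]) auto
    from con_insertD[OF this] have "(x, u) \<in> con (G \<union> F) \<and> (v, y) \<in> con (G \<union> F) \<or>
        (x, v) \<in> con (G \<union> F) \<and> (u, y) \<in> con (G \<union> F)"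
      using assms(1) F con_mono[of "G \<union> (F - {{x, y}})" "G \<union> F"]
      by (auto simp: forest_over_def)
    moreover have "(x, y) \<in> con (G \<union> F)"
      using F by (intro con_edge) simp
    ultimately have "(u, v) \<in> con (G \<union> F)"
      by (meson con_sym rtrancl_trans)
    with assms(2) show False ..
  qed
qed

section \<open>Components of a fixed graph as blocks\<close>

text \<open>The blocks are components of \<open>G\<close>, and the vertex set is implicitly
  \<open>\<Union>P\<close>. \<open>G\<close> stays fixed while collections of blocks vary, as the
  recursions on sub-collections require.\<close>

locale blocks =
  fixes G :: "'a set set" and P :: "'a set set"
  assumes finite_P: "finite P"
    and finite_block: "b \<in> P \<Longrightarrow> finite b"
    and block_ne: "b \<in> P \<Longrightarrow> b \<noteq> {}"
    and block_class: "b \<in> P \<Longrightarrow> u \<in> b \<Longrightarrow> con G `` {u} = b"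
    and card_edge: "e \<in> G \<Longrightarrow> card e = 2"
begin

definition forests :: "'a set set \<Rightarrow> 'a set set set" where
  "forests J = {F \<in> graphs_on (\<Union>J). forest_over G F}"

definition trees :: "'a set set \<Rightarrow> 'a set set set" where
  "trees J = {F \<in> forests J. \<forall>u\<in>\<Union>J. \<forall>v\<in>\<Union>J. (u, v) \<in> con (G \<union> F)}"

lemma block_disjoint:
  assumes "b \<in> P" "c \<in> P" "u \<in> b" "u \<in> c"
  shows "b = c"
  using block_class[OF assms(1,3)] block_class[OF assms(2,4)] by simp

lemma Union_diff:
  assumes "J \<subseteq> I" "I \<subseteq> P"
  shows "\<Union>(I - J) = \<Union>I - \<Union>J"
proof -
  have "u \<notin> c" if "u \<in> b" "b \<in> I - J" "c \<in> J" for u b c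
    using that assms block_disjoint[of b c u] by blast
  then show ?thesis
    by blast
qed

lemma Union_disjoint:
  assumes "J \<subseteq> P" "K \<subseteq> P" "J \<inter> K = {}"
  shows "\<Union>J \<inter> \<Union>K = {}"
proof -
  have "u \<notin> c" if "u \<in> b" "b \<in> J" "c \<in> K" for u b c
    using that assms block_disjoint[of b c u] by blast
  then show ?thesis
    by blast
qed

lemma Union_inject:
  assumes "J \<subseteq> P" "K \<subseteq> P" "\<Union>J = \<Union>K"
  shows "J = K"
proof -
  have *: "J \<subseteq> K" if JK: "J \<subseteq> P" "K \<subseteq> P" "\<Union>J \<subseteq> \<Union>K" for J K
  proof
    fix b assume b: "b \<in> J"
    then obtain u where u: "u \<in> b"
      using block_ne JK(1) by blast
    then obtain c where c: "c \<in> K" "u \<in> c"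
      using b JK(3) by blast
    then have "b = c"
      using block_disjoint[of b c u] u b JK by blast
    with c show "b \<in> K"
      by simp
  qed
  show ?thesis
    using *[of J K] *[of K J] assms by simp
qed

lemma finite_Union_blocks:
  assumes "J \<subseteq> P"
  shows "finite (\<Union>J)"
proof (rule finite_Union)
  show "finite J"
    using assms finite_P by (rule finite_subset)
  show "finite b" if "b \<in> J" for b
    using that assms finite_block by blast
qed

lemma card_Union_blocks:
  assumes "J \<subseteq> P"
  shows "card (\<Union>J) = (\<Sum>b\<in>J. card b)"
proof (rule card_Union_disjoint)
  show "pairwise disjnt J"
  proof (rule pairwiseI)
    fix b c assume "b \<in> J" "c \<in> J" "b \<noteq> c"
    then show "disjnt b c"
      unfolding disjnt_iff using block_disjoint[of b c] assms by blast
  qed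
  show "finite b" if "b \<in> J" for b
    using that finite_block assms by blast
qed

lemma G_closed:
  assumes "J \<subseteq> P" "e \<in> G" "e \<inter> \<Union>J \<noteq> {}"
  shows "e \<subseteq> \<Union>J"
proof -
  obtain u b where u: "u \<in> e" "b \<in> J" "u \<in> b"
    using assms by blast
  have "v \<in> b" if "v \<in> e" for v
  proof -
    have "(u, v) \<in> con G"
    proof (cases "u = v")
      case False
      with card_edge[OF assms(2)] u that have "e = {u, v}"
        by (auto simp: card_2_iff)
      then show ?thesis
        using con_edge[of u v G] assms(2) by simp
    qed simp
    then show ?thesis
      using block_class[of b u] u assms by blast
  qed
  with u show ?thesis
    by blast
qed

lemma closed_eq_Union:
  assumes "I \<subseteq> P" "A \<subseteq> \<Union>I" "\<And>x y. x \<in> A \<Longrightarrow> (x, y) \<in> con G \<Longrightarrow> y \<in> A"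
  obtains J where "J \<subseteq> I" "A = \<Union>J"
proof
  show "{b \<in> I. b \<subseteq> A} \<subseteq> I"
    by blast
  show "A = \<Union>{b \<in> I. b \<subseteq> A}"
  proof (intro equalityI subsetI)
    fix x assume x: "x \<in> A"
    then obtain b where "b \<in> I" "x \<in> b"
      using assms by blast
    moreover have "b \<subseteq> A"
      using block_class[of b x] x assms calculation by blast
    ultimately show "x \<in> \<Union>{b \<in> I. b \<subseteq> A}"
      by blast
  qed blast
qed

text \<open>No edge of \<open>F2\<close> meets \<open>\<Union>J\<close> and no edge of
  \<open>G\<close> leaves it, so \<open>con_local\<close> applies.\<close>

lemma con_union_local:
  assumes "J \<subseteq> P" "K \<subseteq> P" "J \<inter> K = {}" "F1 \<in> graphs_on (\<Union>J)" "F2 \<in> graphs_on (\<Union>K)"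
    and "(x, y) \<in> con (G \<union> (F1 \<union> F2))" "x \<in> \<Union>J"
  shows "(x, y) \<in> con (G \<union> F1) \<and> y \<in> \<Union>J"
  using assms(6,7)
proof (rule con_local)
  fix e assume e: "e \<in> G \<union> (F1 \<union> F2)" "e \<inter> \<Union>J \<noteq> {}"
  have "\<Union>J \<inter> \<Union>K = {}"
    using Union_disjoint assms by blast
  moreover have "e \<subseteq> \<Union>K" if "e \<in> F2"
    using that assms(5) by (auto simp: graphs_on_def)
  ultimately have "e \<notin> F2"
    using e(2) by blast
  then show "e \<subseteq> \<Union>J \<and> e \<in> G \<union> F1"
    using e G_closed[OF assms(1)] assms(4) by (auto simp: graphs_on_def)
qed

lemma con_stays:
  assumes "J \<subseteq> P" "F \<in> graphs_on (\<Union>J)" "(x, y) \<in> con (G \<union> F)" "x \<in> \<Union>J"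
  shows "y \<in> \<Union>J"
  using con_union_local[of J "{}" F "{}" x y] assms by (simp add: graphs_on_def)

lemma forests_union:
  assumes "J \<subseteq> P" "K \<subseteq> P" "J \<inter> K = {}" "F1 \<in> forests J" "F2 \<in> forests K"
  shows "F1 \<union> F2 \<in> forests (J \<union> K)"
proof -
  have g: "F1 \<in> graphs_on (\<Union>J)" "F2 \<in> graphs_on (\<Union>K)" and f: "forest_over G F1" "forest_over G F2"
    using assms(4,5) by (auto simp: forests_def)
  \<comment> \<open>Stated for arbitrary \<open>J\<close> and \<open>K\<close>, so that it serves
    both halves of the union.\<close>
  have *: False
    if "J \<subseteq> P" "K \<subseteq> P" "J \<inter> K = {}" and g: "F1 \<in> graphs_on (\<Union>J)" "F2 \<in> graphs_on (\<Union>K)"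
      and "forest_over G F1" and e: "{u, v} \<in> F1" and c: "(u, v) \<in> con (G \<union> ((F1 \<union> F2) - {{u, v}}))"
    for J K F1 F2 u v
  proof -
    have g': "F1 - {{u, v}} \<in> graphs_on (\<Union>J)" "F2 - {{u, v}} \<in> graphs_on (\<Union>K)"
      using g by (auto simp: graphs_on_def)
    have "u \<in> \<Union>J"
      using g e by (auto simp: graphs_on_def)
    with con_union_local[OF that(1-3) g', of u v] c have "(u, v) \<in> con (G \<union> (F1 - {{u, v}}))"
      by (simp add: Un_Diff)
    with e \<open>forest_over G F1\<close> show False
      by (auto simp: forest_over_def)
  qed
  have "forest_over G (F1 \<union> F2)"
    unfolding forest_over_def
  proof (intro allI impI notI)
    fix u v assume e: "{u, v} \<in> F1 \<union> F2" and c: "(u, v) \<in> con (G \<union> ((F1 \<union> F2) - {{u, v}}))"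
    from e show False
    proof
      assume "{u, v} \<in> F1"
      with *[OF assms(1-3) g f(1) _ c] show False .
    next
      assume "{u, v} \<in> F2"
      moreover have "(u, v) \<in> con (G \<union> ((F2 \<union> F1) - {{u, v}}))"
        using c by (simp add: Un_commute)
      ultimately show False
        using *[OF assms(2,1) _ g(2,1) f(2), of u v] assms(3) by blast
    qed
  qed
  moreover have "F1 \<union> F2 \<in> graphs_on (\<Union>(J \<union> K))"
    using g by (auto simp: graphs_on_def)
  ultimately show ?thesis
    by (simp add: forests_def)
qed

text \<open>The component of \<open>x\<close> is closed under \<open>con G\<close>, hence a union of
  blocks, and no edge of \<open>F\<close> crosses its boundary; \<open>F1\<close> and
  \<open>F2\<close> are the edges inside and outside.\<close>

lemma component_split:
  assumes "I \<subseteq> P" "F \<in> forests I" "x \<in> \<Union>I"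
  obtains J F1 F2 where "J \<subseteq> I" "\<Union>J = con (G \<union> F) `` {x}" "F1 \<in> trees J" "F2 \<in> forests (I - J)"
    "F = F1 \<union> F2"
proof -
  let ?A = "con (G \<union> F) `` {x}"
  have gF: "F \<in> graphs_on (\<Union>I)" and fF: "forest_over G F"
    using assms by (auto simp: forests_def)
  have "?A \<subseteq> \<Union>I"
    using con_stays[OF assms(1) gF] assms(3) by blast
  moreover have "z \<in> ?A" if "y \<in> ?A" "(y, z) \<in> con G" for y z
    using that con_mono[of G "G \<union> F" y z] by (auto intro: rtrancl_trans)
  ultimately obtain J where J: "J \<subseteq> I" "?A = \<Union>J"
    using closed_eq_Union[OF assms(1), of ?A] by blast
  have F_closed: "e \<subseteq> ?A" if e: "e \<in> F" "e \<inter> ?A \<noteq> {}" for e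
  proof -
    obtain u v where uv: "e = {u, v}"
      using edge_elem[OF gF e(1)] by blast
    then have "(u, v) \<in> con (G \<union> F)" "(v, u) \<in> con (G \<union> F)"
      using e con_edge[of u v "G \<union> F"] con_sym[of u v] by auto
    then show ?thesis
      using e uv by (auto intro: rtrancl_trans)
  qed
  define F1 F2 where "F1 = F \<inter> Pow ?A" and "F2 = F - Pow ?A"
  have "F1 \<in> graphs_on (\<Union>J)"
    using gF J by (auto simp: F1_def graphs_on_def)
  moreover have "forest_over G F1"
    using forest_over_subset[OF fF] by (auto simp: F1_def)
  moreover have "(u, v) \<in> con (G \<union> F1)" if "u \<in> \<Union>J" "v \<in> \<Union>J" for u v
  proof -
    have "(u, v) \<in> con (G \<union> F)"
      using that J(2) by (metis Image_singleton_iff con_sym rtrancl_trans)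
    then show ?thesis
    proof (rule con_local[THEN conjunct1, OF _ that(1)])
      fix e assume e: "e \<in> G \<union> F" "e \<inter> \<Union>J \<noteq> {}"
      have "e \<subseteq> \<Union>J"
        using e F_closed[of e] G_closed[of J e] J assms(1) by (metis Un_iff order_trans)
      with e show "e \<subseteq> \<Union>J \<and> e \<in> G \<union> F1"
        using J(2) by (simp add: F1_def)
    qed
  qed
  ultimately have "F1 \<in> trees J"
    unfolding trees_def forests_def by blast
  moreover have "F2 \<in> forests (I - J)"
  proof -
    have "e \<subseteq> \<Union>(I - J)" if "e \<in> F2" for e
    proof -
      have "e \<inter> ?A = {}"
        using that F_closed by (auto simp: F2_def)
      moreover have "e \<subseteq> \<Union>I"
        using that gF by (auto simp: F2_def graphs_on_def)
      ultimately show ?thesis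
        using Union_diff[OF J(1) assms(1)] J(2) by blast
    qed
    then have "F2 \<in> graphs_on (\<Union>(I - J))"
      using gF by (auto simp: F2_def graphs_on_def)
    then show ?thesis
      using forest_over_subset[OF fF] by (auto simp: forests_def F2_def)
  qed
  moreover have "F = F1 \<union> F2"
    by (auto simp: F1_def F2_def)
  ultimately show ?thesis
    using that J by metis
qed

text \<open>The converse of \<open>component_split\<close>: \<open>\<Union>J\<close> can be read off
  from \<open>F1 \<union> F2\<close> as a component, which gives injectivity in the counts
  below.\<close>

lemma trees_component:
  assumes "J \<subseteq> I" "I \<subseteq> P" "F1 \<in> trees J" "F2 \<in> forests (I - J)" "x \<in> \<Union>J"
  shows "con (G \<union> (F1 \<union> F2)) `` {x} = \<Union>J"
proof (intro equalityI subsetI)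
  fix y assume "y \<in> con (G \<union> (F1 \<union> F2)) `` {x}"
  then show "y \<in> \<Union>J"
    using con_union_local[of J "I - J" F1 F2 x y] assms by (auto simp: trees_def forests_def)
next
  fix y assume "y \<in> \<Union>J"
  then have "(x, y) \<in> con (G \<union> F1)"
    using assms by (auto simp: trees_def)
  then show "y \<in> con (G \<union> (F1 \<union> F2)) `` {x}"
    using con_mono[of "G \<union> F1" "G \<union> (F1 \<union> F2)" x y] by auto
qed

lemma graphs_on_disjoint:
  assumes "J \<subseteq> I" "I \<subseteq> P" "F1 \<in> graphs_on (\<Union>J)" "F2 \<in> graphs_on (\<Union>(I - J))"
  shows "F1 \<inter> F2 = {}"
proof -
  have dis: "\<Union>J \<inter> \<Union>(I - J) = {}"
    using Union_diff[OF assms(1,2)] by blast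
  have "e \<notin> F1" if e: "e \<in> F2" for e
  proof
    assume "e \<in> F1"
    then have "e \<subseteq> \<Union>J"
      using assms(3) by (auto simp: graphs_on_def)
    moreover obtain u where "u \<in> e" "u \<in> \<Union>(I - J)"
      using edge_elem[OF assms(4) e] by (metis insertI1)
    ultimately show False
      using dis by blast
  qed
  then show ?thesis
    by blast
qed

lemma graphs_union_eqD:
  assumes "J \<subseteq> I" "I \<subseteq> P" "F1 \<in> graphs_on (\<Union>J)" "F1' \<in> graphs_on (\<Union>J)"
    and "F2 \<in> graphs_on (\<Union>(I - J))" "F2' \<in> graphs_on (\<Union>(I - J))" "F1 \<union> F2 = F1' \<union> F2'"
  shows "F1 = F1' \<and> F2 = F2'"
proof -
  have dis: "F1 \<inter> F2 = {}" if "F1 \<in> graphs_on (\<Union>J)" "F2 \<in> graphs_on (\<Union>(I - J))" for F1 F2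
    using that by (rule graphs_on_disjoint[OF assms(1,2)])
  show ?thesis
    using dis[OF assms(3,5)] dis[OF assms(3,6)] dis[OF assms(4,5)] dis[OF assms(4,6)] assms(7)
    by blast
qed

lemma finite_forests: "J \<subseteq> P \<Longrightarrow> finite (forests J)"
  using finite_graphs_on[OF finite_Union_blocks] by (simp add: forests_def)

lemma finite_trees: "J \<subseteq> P \<Longrightarrow> finite (trees J)"
  using finite_forests by (simp add: trees_def)

section \<open>Recursions for forests and trees\<close>

text \<open>A forest is determined by the tree through a vertex \<open>x\<close> of the fixed block
  \<open>r\<close>, the blocks \<open>J\<close> of that tree, and the forest on the other
  blocks.\<close>

lemma card_forests_rec:
  assumes "I \<subseteq> P" "r \<in> I"
  shows "card (forests I) = (\<Sum>J\<in>{J. r \<in> J \<and> J \<subseteq> I}. card (trees J) * card (forests (I - J)))"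
proof -
  obtain x where x: "x \<in> r"
    using block_ne assms by blast
  let ?S = "{J. r \<in> J \<and> J \<subseteq> I}"
  let ?D = "SIGMA J:?S. trees J \<times> forests (I - J)"
  have finI: "finite I"
    using assms(1) finite_P by (rule finite_subset)
  have "bij_betw (\<lambda>(J, F1, F2). F1 \<union> F2) ?D (forests I)"
    unfolding bij_betw_def
  proof
    show "inj_on (\<lambda>(J, F1, F2). F1 \<union> F2) ?D"
    proof (rule inj_onI)
      fix p q
      assume D: "p \<in> ?D" "q \<in> ?D" "(\<lambda>(J, F1, F2). F1 \<union> F2) p = (\<lambda>(J, F1, F2). F1 \<union> F2) q"
      from D(1) obtain J F1 F2 where p: "p = (J, F1, F2)"
        and a: "r \<in> J" "J \<subseteq> I" "F1 \<in> trees J" "F2 \<in> forests (I - J)"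
        by (elim SigmaE) auto
      from D(2) obtain J' F1' F2' where q: "q = (J', F1', F2')"
        and b: "r \<in> J'" "J' \<subseteq> I" "F1' \<in> trees J'" "F2' \<in> forests (I - J')"
        by (elim SigmaE) auto
      have eq: "F1 \<union> F2 = F1' \<union> F2'"
        using D(3) p q by simp
      have "\<Union>J = \<Union>J'"
        using trees_component[OF a(2) assms(1) a(3,4), of x] trees_component[OF b(2) assms(1) b(3,4), of x]
          UnionI[OF a(1) x] UnionI[OF b(1) x] eq by simp
      then have J: "J = J'"
        using a(2) b(2) assms(1) by (intro Union_inject) auto
      have "F1 = F1' \<and> F2 = F2'"
        using a b eq unfolding J
        by (intro graphs_union_eqD[OF b(2) assms(1)]) (auto simp: trees_def forests_def)
      with J show "p = q"
        by (simp add: p q)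
    qed
    show "(\<lambda>(J, F1, F2). F1 \<union> F2) ` ?D = forests I"
    proof (intro equalityI subsetI)
      fix F assume "F \<in> (\<lambda>(J, F1, F2). F1 \<union> F2) ` ?D"
      then obtain J F1 F2 where J: "J \<subseteq> I" "F1 \<in> trees J" "F2 \<in> forests (I - J)" "F = F1 \<union> F2"
        by auto
      then have "J \<union> (I - J) = I"
        by blast
      then show "F \<in> forests I"
        using forests_union[of J "I - J" F1 F2] J assms by (auto simp: trees_def)
    next
      fix F assume F: "F \<in> forests I"
      then obtain J F1 F2 where J: "J \<subseteq> I" "\<Union>J = con (G \<union> F) `` {x}" "F1 \<in> trees J"
        "F2 \<in> forests (I - J)" "F = F1 \<union> F2"
        using component_split[OF assms(1) F, of x] x assms by blast
      have "x \<in> \<Union>J"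
        using J(2) by auto
      then have "r \<in> J"
        using x block_disjoint[of r _ x] assms J(1) by blast
      with J show "F \<in> (\<lambda>(J, F1, F2). F1 \<union> F2) ` ?D"
        by (intro image_eqI[of _ _ "(J, F1, F2)"]) auto
    qed
  qed
  then have "card (forests I) = card ?D"
    by (rule bij_betw_same_card[symmetric])
  also have "\<dots> = (\<Sum>J\<in>?S. card (trees J \<times> forests (I - J)))"
  proof (rule card_SigmaI)
    show "finite ?S"
      using finI by (auto intro: finite_subset[of _ "Pow I"])
    show "\<forall>J\<in>?S. finite (trees J \<times> forests (I - J))"
    proof
      fix J assume "J \<in> ?S"
      then have "J \<subseteq> P" "I - J \<subseteq> P"
        using assms(1) by auto
      then show "finite (trees J \<times> forests (I - J))"
        using finite_trees finite_forests by simp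
    qed
  qed
  finally show ?thesis
    by (simp add: card_cartesian_product)
qed

text \<open>\<open>J\<close> collects the blocks still reachable from \<open>u\<close> once the edge
  is gone.\<close>

lemma tree_edge_split:
  assumes "I \<subseteq> P" "F \<in> trees I" "{u, v} \<in> F"
  obtains J F1 F2 where "J \<subseteq> I" "F1 \<in> trees J" "F2 \<in> trees (I - J)" "u \<in> \<Union>J" "v \<in> \<Union>(I - J)"
    "F - {{u, v}} = F1 \<union> F2"
proof -
  let ?F = "F - {{u, v}}"
  have F: "F \<in> forests I" "F \<in> graphs_on (\<Union>I)" "forest_over G F"
    and conF: "\<And>x y. x \<in> \<Union>I \<Longrightarrow> y \<in> \<Union>I \<Longrightarrow> (x, y) \<in> con (G \<union> F)"
    using assms by (auto simp: trees_def forests_def)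
  have u: "u \<in> \<Union>I" "v \<in> \<Union>I"
    using F(2) assms(3) by (auto simp: graphs_on_def)
  have "?F \<in> forests I"
    using F forest_over_subset[OF F(3), of ?F] by (auto simp: forests_def graphs_on_def)
  then obtain J F1 F2 where J: "J \<subseteq> I" "\<Union>J = con (G \<union> ?F) `` {u}" "F1 \<in> trees J"
    "F2 \<in> forests (I - J)" "?F = F1 \<union> F2"
    using component_split[OF assms(1) _ u(1)] by metis
  have nuv: "(u, v) \<notin> con (G \<union> ?F)"
    using F(3) assms(3) by (auto simp: forest_over_def)
  then have v: "v \<in> \<Union>(I - J)"
    using Union_diff[OF J(1) assms(1)] u J(2) by auto
  \<comment> \<open>If a walk from \<open>v\<close> to \<open>y\<close> needed the deleted edge,
    \<open>y\<close> would lie in the part of \<open>u\<close>.\<close>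
  have vy: "(v, y) \<in> con (G \<union> F2)" if y: "y \<in> \<Union>(I - J)" for y
  proof -
    have yJ: "(u, y) \<notin> con (G \<union> ?F)" "y \<in> \<Union>I"
      using y Union_diff[OF J(1) assms(1)] J(2) by auto
    have "(v, y) \<in> con (insert {u, v} (G \<union> ?F))"
      using conF[OF u(2) yJ(2)] by (rule con_mono[rotated]) auto
    from con_insertD[OF this] have "(v, y) \<in> con (G \<union> ?F)"
      using nuv yJ con_sym by metis
    then have "(v, y) \<in> con (G \<union> (F2 \<union> F1))"
      unfolding J(5) by (simp add: Un_commute)
    then show ?thesis
      using con_union_local[of "I - J" J F2 F1 v y] J assms(1) v
      by (auto simp: trees_def forests_def)
  qed
  have "F2 \<in> trees (I - J)"
    unfolding trees_def using J(4) vy by (blast intro: con_sym rtrancl_trans)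
  moreover have "u \<in> \<Union>J"
    unfolding J(2) by simp
  ultimately show ?thesis
    using that[OF J(1,3)] v J(5) by metis
qed

text \<open>Inverse to \<open>tree_edge_split\<close>; by the second conclusion, deleting the edge
  again recovers \<open>F1 \<union> F2\<close>.\<close>

lemma tree_edge_join:
  assumes "J \<subseteq> I" "I \<subseteq> P" "F1 \<in> trees J" "F2 \<in> trees (I - J)" "u \<in> \<Union>J" "v \<in> \<Union>(I - J)"
  shows "insert {u, v} (F1 \<union> F2) \<in> trees I" "{u, v} \<notin> F1 \<union> F2"
proof -
  have dis: "\<Union>J \<inter> \<Union>(I - J) = {}"
    using Union_diff[OF assms(1,2)] by blast
  have II: "J \<union> (I - J) = I"
    using assms by blast
  have F: "F1 \<union> F2 \<in> forests I"
    using forests_union[of J "I - J" F1 F2] assms II by (auto simp: trees_def)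
  have "v \<notin> con (G \<union> (F1 \<union> F2)) `` {u}"
    using trees_component[OF assms(1,2,3) _ assms(5), of F2] assms dis by (auto simp: trees_def)
  then have n: "(u, v) \<notin> con (G \<union> (F1 \<union> F2))"
    by simp
  then show "{u, v} \<notin> F1 \<union> F2"
    using con_edge[of u v "G \<union> (F1 \<union> F2)"] by blast
  have "forest_over G (insert {u, v} (F1 \<union> F2))"
    using F n by (intro forest_over_insert) (auto simp: forests_def)
  moreover have "insert {u, v} (F1 \<union> F2) \<in> graphs_on (\<Union>I)"
  proof -
    have "u \<noteq> v"
      using assms dis by blast
    then show ?thesis
      using F assms by (auto simp: forests_def graphs_on_def)
  qed
  ultimately have "insert {u, v} (F1 \<union> F2) \<in> forests I"
    by (simp add: forests_def)
  moreover have "(u, y) \<in> con (G \<union> insert {u, v} (F1 \<union> F2))" if y: "y \<in> \<Union>I" for y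
  proof -
    let ?H = "G \<union> insert {u, v} (F1 \<union> F2)"
    consider "y \<in> \<Union>J" | "y \<in> \<Union>(I - J)"
      using y by blast
    then show ?thesis
    proof cases
      case 1
      then have "(u, y) \<in> con (G \<union> F1)"
        using assms by (auto simp: trees_def)
      then show ?thesis
        by (rule con_mono[rotated]) auto
    next
      case 2
      then have "(v, y) \<in> con (G \<union> F2)"
        using assms by (auto simp: trees_def)
      then have "(v, y) \<in> con ?H"
        by (rule con_mono[rotated]) auto
      moreover have "(u, v) \<in> con ?H"
        by (intro con_edge) simp
      ultimately show ?thesis
        by (rule rtrancl_trans[rotated])
    qed
  qed
  ultimately show "insert {u, v} (F1 \<union> F2) \<in> trees I"
    unfolding trees_def by (auto intro: rtrancl_trans con_sym)
qed

lemma card_tree_edges: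
  assumes "I \<subseteq> P" "I \<noteq> {}" "F \<in> trees I"
  shows "card F = card I - 1"
  using assms
proof (induction "card I" arbitrary: I F rule: less_induct)
  case less
  have finI: "finite I"
    using less.prems(1) finite_P by (rule finite_subset)
  show ?case
  proof (cases "F = {}")
    case True
    \<comment> \<open>Without edges all blocks lie in a single component of \<open>G\<close>, so
      there is at most one.\<close>
    have "b = c" if bc: "b \<in> I" "c \<in> I" for b c
    proof -
      obtain x y where "x \<in> b" "y \<in> c"
        using block_ne bc less.prems(1) by blast
      moreover from this have "(x, y) \<in> con G"
        using less.prems(3) bc True by (auto simp: trees_def)
      ultimately show ?thesis
        using block_class[of b x] block_disjoint[of b c y] bc less.prems(1) by blast
    qed
    then have "card I \<le> 1"
      using finI by (simp add: card_le_Suc0_iff_eq)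
    with True show ?thesis
      by simp
  next
    case False
    then obtain e where "e \<in> F"
      by blast
    moreover have gF: "F \<in> graphs_on (\<Union>I)"
      using less.prems by (simp add: trees_def forests_def)
    ultimately obtain u v where uv: "{u, v} \<in> F"
      using edge_elem by metis
    obtain J F1 F2 where J: "J \<subseteq> I" "F1 \<in> trees J" "F2 \<in> trees (I - J)" "u \<in> \<Union>J" "v \<in> \<Union>(I - J)"
      "F - {{u, v}} = F1 \<union> F2"
      using tree_edge_split[OF less.prems(1,3) uv] by metis
    have ne: "J \<noteq> {}" "I - J \<noteq> {}"
      using J by auto
    have finF: "finite F"
      using gF finite_Union_blocks[OF less.prems(1)] finite_subset[of F "Pow (\<Union>I)"]
      by (auto simp: graphs_on_def)
    have fin12: "finite F1" "finite F2"
      using J(6) finF by (metis finite_Diff finite_Un)+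
    have cJ: "card J < card I" "card (I - J) < card I"
      using J(1) ne finI by (auto intro!: psubset_card_mono)
    have "card F1 = card J - 1" "card F2 = card (I - J) - 1"
      using less.hyps[OF cJ(1) _ ne(1) J(2)] less.hyps[OF cJ(2) _ ne(2) J(3)] J(1) less.prems(1) by auto
    moreover have "F1 \<inter> F2 = {}"
      using J(2,3) by (intro graphs_on_disjoint[OF J(1) less.prems(1)]) (auto simp: trees_def forests_def)
    then have "card (F - {{u, v}}) = card F1 + card F2"
      unfolding J(6) using fin12 by (simp add: card_Un_disjoint)
    moreover have "card F = Suc (card (F - {{u, v}}))"
      using uv finF by (rule card.remove[rotated])
    moreover have "card (I - J) = card I - card J"
      using J(1) finI by (simp add: card_Diff_subset finite_subset)
    moreover have "card J > 0" "card J < card I"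
      using ne cJ J(1) finI by (auto simp: card_gt_0_iff finite_subset)
    ultimately show ?thesis
      by linarith
  qed
qed

text \<open>Trees with an oriented edge are counted in two ways: a tree has
  \<open>card I - 1\<close> edges with two orientations each, and cutting the edge leaves two trees
  with a marked end vertex in each.\<close>

lemma card_trees_rec:
  assumes "I \<subseteq> P" "I \<noteq> {}"
  shows "2 * (card I - 1) * card (trees I) =
    (\<Sum>J\<in>Pow I. (card (\<Union>J) * card (trees J)) * (card (\<Union>(I - J)) * card (trees (I - J))))"
proof -
  let ?D = "SIGMA J:Pow I. trees J \<times> trees (I - J) \<times> \<Union>J \<times> \<Union>(I - J)"
  let ?R = "SIGMA F:trees I. {(u, v). {u, v} \<in> F}"
  let ?f = "\<lambda>(J, F1, F2, u, v). (insert {u, v} (F1 \<union> F2), u, v)"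
  have finI: "finite I"
    using assms(1) finite_P by (rule finite_subset)
  have "bij_betw ?f ?D ?R"
    unfolding bij_betw_def
  proof
    show "inj_on ?f ?D"
    proof (rule inj_onI)
      fix p q
      assume D: "p \<in> ?D" "q \<in> ?D" "?f p = ?f q"
      from D(1) obtain J F1 F2 u v where p: "p = (J, F1, F2, u, v)"
        and a: "J \<subseteq> I" "F1 \<in> trees J" "F2 \<in> trees (I - J)" and c1: "u \<in> \<Union>J" "v \<in> \<Union>(I - J)"
        by (elim SigmaE) auto
      from D(2) obtain J' F1' F2' u' v' where q: "q = (J', F1', F2', u', v')"
        and b: "J' \<subseteq> I" "F1' \<in> trees J'" "F2' \<in> trees (I - J')" and c2: "u' \<in> \<Union>J'" "v' \<in> \<Union>(I - J')"
        by (elim SigmaE) auto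
      have uv: "u' = u" "v' = v" and eq: "insert {u, v} (F1 \<union> F2) = insert {u, v} (F1' \<union> F2')"
        using D(3) p q by auto
      have c: "u \<in> \<Union>J" "v \<in> \<Union>(I - J)" "u \<in> \<Union>J'" "v \<in> \<Union>(I - J')"
        using c1 c2 uv by simp_all
      have "{u, v} \<notin> F1 \<union> F2" "{u, v} \<notin> F1' \<union> F2'"
        using tree_edge_join(2)[OF a(1) assms(1) a(2,3) c(1,2)]
          tree_edge_join(2)[OF b(1) assms(1) b(2,3) c(3,4)] by simp_all
      then have eq': "F1 \<union> F2 = F1' \<union> F2'"
        using eq by (metis Diff_insert_absorb)
      have t: "F2 \<in> forests (I - J)" "F2' \<in> forests (I - J')"
        using a b by (auto simp: trees_def)
      have "\<Union>J = \<Union>J'"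
        using trees_component[OF a(1) assms(1) a(2) t(1) c(1)] trees_component[OF b(1) assms(1) b(2) t(2) c(3)] eq'
        by simp
      then have J: "J = J'"
        using a(1) b(1) assms(1) by (intro Union_inject) auto
      have "F1 = F1' \<and> F2 = F2'"
        using a b eq' unfolding J
        by (intro graphs_union_eqD[OF b(1) assms(1)]) (auto simp: trees_def forests_def)
      with J uv show "p = q"
        by (simp add: p q)
    qed
    show "?f ` ?D = ?R"
    proof (intro equalityI subsetI)
      fix z assume "z \<in> ?f ` ?D"
      then obtain J F1 F2 u v where z: "z = (insert {u, v} (F1 \<union> F2), u, v)"
        and J: "J \<subseteq> I" "F1 \<in> trees J" "F2 \<in> trees (I - J)" "u \<in> \<Union>J" "v \<in> \<Union>(I - J)"
        by (elim imageE SigmaE) auto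
      show "z \<in> ?R"
        using tree_edge_join(1)[OF J(1) assms(1) J(2-5)] by (simp add: z)
    next
      fix z assume "z \<in> ?R"
      then obtain F u v where z: "z = (F, u, v)" "F \<in> trees I" "{u, v} \<in> F"
        by auto
      obtain J F1 F2 where J: "J \<subseteq> I" "F1 \<in> trees J" "F2 \<in> trees (I - J)" "u \<in> \<Union>J" "v \<in> \<Union>(I - J)"
        "F - {{u, v}} = F1 \<union> F2"
        using tree_edge_split[OF assms(1) z(2,3)] by metis
      have "z = ?f (J, F1, F2, u, v)"
        using z J(6) by auto
      then show "z \<in> ?f ` ?D"
        using J by (intro image_eqI[of _ _ "(J, F1, F2, u, v)"]) auto
    qed
  qed
  then have "card ?R = card ?D"
    by (rule bij_betw_same_card[symmetric])
  also have "\<dots> = (\<Sum>J\<in>Pow I. card (trees J \<times> trees (I - J) \<times> \<Union>J \<times> \<Union>(I - J)))"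
  proof (rule card_SigmaI, simp add: finI, intro ballI)
    fix J assume "J \<in> Pow I"
    then have "J \<subseteq> P" "I - J \<subseteq> P"
      using assms by auto
    then show "finite (trees J \<times> trees (I - J) \<times> \<Union>J \<times> \<Union>(I - J))"
      using finite_trees finite_Union_blocks by simp
  qed
  also have "\<dots> = (\<Sum>J\<in>Pow I. (card (\<Union>J) * card (trees J)) * (card (\<Union>(I - J)) * card (trees (I - J))))"
    by (simp add: card_cartesian_product mult_ac)
  finally have D: "card ?R = \<dots>" .
  have cardF: "finite {(u, v). {u, v} \<in> F} \<and> card {(u, v). {u, v} \<in> F} = 2 * card F"
    if "F \<in> graphs_on X" "finite X" for F :: "'a set set" and X
  proof -
    have fF: "finite F"
      using that finite_subset[of F "Pow X"] by (auto simp: graphs_on_def)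
    have eq: "{(u, v). {u, v} \<in> F} = (\<Union>e\<in>F. {(u, v). {u, v} = e})"
      by auto
    have two: "finite {(u, v). {u, v} = e} \<and> card {(u, v). {u, v} = e} = 2" if e: "e \<in> F" for e
    proof -
      obtain a b where ab: "e = {a, b}" "a \<noteq> b"
        using edge_elem[OF \<open>F \<in> graphs_on X\<close> e] by blast
      have "{(u, v). {u, v} = e} = {(a, b), (b, a)}"
        using ab by (auto simp: doubleton_eq_iff)
      then show ?thesis
        using ab by simp
    qed
    have "card (\<Union>e\<in>F. {(u, v). {u, v} = e}) = (\<Sum>e\<in>F. card {(u, v). {u, v} = e})"
      using fF two by (intro card_UN_disjoint) auto
    then show ?thesis
      unfolding eq using fF two by simp
  qed
  have "card ?R = (\<Sum>F\<in>trees I. card {(u, v). {u, v} \<in> F})"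
  proof (rule card_SigmaI)
    show "finite (trees I)"
      using finite_trees assms by blast
    show "\<forall>F\<in>trees I. finite {(u, v). {u, v} \<in> F}"
      using cardF[OF _ finite_Union_blocks[OF assms(1)]] by (auto simp: trees_def forests_def)
  qed
  also have "\<dots> = (\<Sum>F\<in>trees I. 2 * (card I - 1))"
  proof (rule sum.cong[OF refl])
    fix F assume F: "F \<in> trees I"
    then have "F \<in> graphs_on (\<Union>I)"
      by (simp add: trees_def forests_def)
    then show "card {(u, v). {u, v} \<in> F} = 2 * (card I - 1)"
      using cardF[OF _ finite_Union_blocks[OF assms(1)]] card_tree_edges[OF assms F] by simp
  qed
  finally show ?thesis
    using D by (simp add: mult_ac)
qed

end

section \<open>Counting trees and forests\<close>

context blocks
begin

abbreviation block_weight :: "'a set \<Rightarrow> real" where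
  "block_weight b \<equiv> real (card b)"

lemma card_block_pos: "b \<in> P \<Longrightarrow> card b > 0"
  using finite_block block_ne by (simp add: card_gt_0_iff)

text \<open>\<open>card_trees_rec\<close> and \<open>conv_rooted_tree_weight\<close> are the same
  recurrence. The factor \<open>2 * (card I - 1)\<close> can be cancelled unless \<open>I\<close> is
  a single block, which is checked directly.\<close>

lemma card_trees:
  assumes "I \<subseteq> P" "I \<noteq> {}"
  shows "real (card (trees I)) = prod block_weight I * tree_weight block_weight I"
  using assms
proof (induction "card I" arbitrary: I rule: less_induct)
  case less
  let ?u = "\<lambda>J. sum block_weight J * tree_weight block_weight J"
  have finI: "finite I"
    using less.prems(1) finite_P by (rule finite_subset)
  have pos: "block_weight b > 0" if "b \<in> I" for b
    using that less.prems(1) card_block_pos by auto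
  show ?case
  proof (cases "card I = 1")
    case True
    then obtain b where b: "I = {b}"
      by (auto simp: card_1_singleton_iff)
    have "F = {}" if F: "F \<in> trees I" for F
    proof -
      have "finite F"
        using F finite_Union_blocks[OF less.prems(1)] finite_subset[of F "Pow (\<Union>I)"]
        by (auto simp: trees_def forests_def graphs_on_def)
      then show ?thesis
        using card_tree_edges[OF less.prems F] True by simp
    qed
    moreover have "{} \<in> trees I"
      using block_class[of b] b less.prems(1)
      by (auto simp: trees_def forests_def graphs_on_def forest_over_def)
    ultimately have "trees I = {{}}"
      by blast
    then show ?thesis
      using b pos[of b] by (simp add: tree_weight_def power2_eq_square)
  next
    case False
    then have n: "card I \<ge> 2"
      using finI less.prems(2) by (metis One_nat_def Suc_1 Suc_leI card_gt_0_iff le_neq_implies_less)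
    have "2 * (real (card I) - 1) * real (card (trees I)) = real (2 * (card I - 1) * card (trees I))"
      using n by (simp add: of_nat_diff)
    also have "\<dots> = (\<Sum>J\<in>Pow I. (real (card (\<Union>J)) * real (card (trees J))) *
        (real (card (\<Union>(I - J))) * real (card (trees (I - J)))))"
      unfolding card_trees_rec[OF less.prems] by simp
    also have "\<dots> = (\<Sum>J\<in>Pow I. prod block_weight I * (?u J * ?u (I - J)))"
    proof (rule sum.cong[OF refl])
      fix J assume J: "J \<in> Pow I"
      show "(real (card (\<Union>J)) * real (card (trees J))) *
        (real (card (\<Union>(I - J))) * real (card (trees (I - J)))) = prod block_weight I * (?u J * ?u (I - J))"
      \<comment> \<open>At these two ends \<open>card (\<Union>{}) = 0\<close> makes both sides
        vanish, although \<open>trees {}\<close> contains the empty graph.\<close>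
      proof (cases "J = {} \<or> J = I")
        case True
        then show ?thesis
          by auto
      next
        case ne: False
        have JP: "J \<subseteq> P" "I - J \<subseteq> P" "J \<noteq> {}" "I - J \<noteq> {}"
          using J ne less.prems(1) by auto
        have lt: "card J < card I" "card (I - J) < card I"
          using J ne finI by (auto intro!: psubset_card_mono)
        have W: "real (card (\<Union>J)) = sum block_weight J" "real (card (\<Union>(I - J))) = sum block_weight (I - J)"
          using JP card_Union_blocks by simp_all
        have p: "prod block_weight I = prod block_weight (I - J) * prod block_weight J"
          using J finI by (intro prod.subset_diff) auto
        show ?thesis
          unfolding W p less.hyps[OF lt(1) JP(1,3)] less.hyps[OF lt(2) JP(2,4)] by (simp add: mult_ac)
      qed
    qed
    also have "\<dots> = prod block_weight I * subset_conv ?u ?u I"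
      by (simp add: subset_conv_def sum_distrib_left)
    also have "\<dots> = 2 * (real (card I) - 1) * (prod block_weight I * tree_weight block_weight I)"
      using conv_rooted_tree_weight[OF finI less.prems(2) pos] by (simp add: mult_ac)
    finally show ?thesis
      using n by simp
  qed
qed

text \<open>\<open>k\<close> is the number of trees. The upper limit \<open>N\<close> is left free
  so that the induction step can use one limit \<open>M\<close> for all sets
  \<open>I - J\<close>.\<close>

lemma card_forests:
  assumes "I \<subseteq> P" "card I \<le> N"
  shows "real (card (forests I)) =
    prod block_weight I * (\<Sum>k\<le>N. conv_power (tree_weight block_weight) k I / fact k)"
  using assms
proof (induction "card I" arbitrary: I N rule: less_induct)
  case less
  let ?t = "tree_weight block_weight"
  have finI: "finite I"
    using less.prems(1) finite_P by (rule finite_subset)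
  show ?case
  proof (cases "I = {}")
    case True
    have "forests {} = {{}}"
      by (auto simp: forests_def graphs_on_def forest_over_def)
    moreover have "(\<Sum>k\<le>N. conv_power ?t k {} / fact k) = (\<Sum>k\<le>N. if k = 0 then 1 else 0)"
      by (intro sum.cong refl) (auto simp: conv_power_eq_0 tree_weight_def)
    ultimately show ?thesis
      using True by simp
  next
    case False
    then obtain r where r: "r \<in> I"
      by blast
    let ?S = "{J. r \<in> J \<and> J \<subseteq> I}"
    obtain M where M: "N = Suc M"
      using less.prems(2) False finI by (metis card_gt_0_iff gr0_conv_Suc less_le_trans)
    have "real (card (forests I)) = (\<Sum>J\<in>?S. real (card (trees J)) * real (card (forests (I - J))))"
      unfolding card_forests_rec[OF less.prems(1) r] by simp
    also have "\<dots> = (\<Sum>J\<in>?S. prod block_weight I *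
        (\<Sum>k\<le>M. ?t J * (conv_power ?t k (I - J) / fact k)))"
    proof (rule sum.cong[OF refl])
      fix J assume J: "J \<in> ?S"
      then have JP: "J \<subseteq> P" "I - J \<subseteq> P" "J \<noteq> {}"
        using less.prems(1) by auto
      have lt: "card (I - J) < card I"
        using J r finI by (intro psubset_card_mono) auto
      have le: "card (I - J) \<le> M"
        using lt less.prems(2) M by simp
      have p: "prod block_weight I = prod block_weight (I - J) * prod block_weight J"
        using J finI by (intro prod.subset_diff) auto
      show "real (card (trees J)) * real (card (forests (I - J))) =
          prod block_weight I * (\<Sum>k\<le>M. ?t J * (conv_power ?t k (I - J) / fact k))"
        unfolding card_trees[OF JP(1,3)] less.hyps[OF lt JP(2) le] p sum_distrib_left[symmetric]
        by (simp add: mult_ac)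
    qed
    also have "\<dots> = prod block_weight I *
        (\<Sum>k\<le>M. \<Sum>J\<in>?S. ?t J * (conv_power ?t k (I - J) / fact k))"
      by (subst sum.swap) (rule sum_distrib_left[symmetric])
    also have "\<dots> = prod block_weight I * (\<Sum>k\<le>M. conv_power ?t (Suc k) I / fact (Suc k))"
      by (simp only: conv_power_root[OF finI r, symmetric])
    also have "(\<Sum>k\<le>M. conv_power ?t (Suc k) I / fact (Suc k)) = (\<Sum>k\<le>N. conv_power ?t k I / fact k)"
      unfolding M sum.atMost_Suc_shift using False by simp
    finally show ?thesis .
  qed
qed

text \<open>The product of the block sizes is common to trees and forests, so only the weights have
  to be compared.\<close>

lemma card_forests_le:
  assumes "P \<noteq> {}"
  shows "real (card (forests P)) \<le> real (card (trees P)) *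
    (\<Sum>k<card P. \<Prod>i=1..k. 1 / (2 * real i) + 5 / (2 * real (card (\<Union>P))))"
proof -
  let ?t = "tree_weight block_weight"
  obtain M where M: "card P = Suc M"
    using assms finite_P by (metis card_gt_0_iff gr0_conv_Suc)
  have "real (card (forests P)) = prod block_weight P * (\<Sum>k\<le>Suc M. conv_power ?t k P / fact k)"
    by (rule card_forests) (simp_all add: M)
  \<comment> \<open>The term \<open>k = 0\<close> vanishes because \<open>P\<close> is
    non-empty.\<close>
  also have "(\<Sum>k\<le>Suc M. conv_power ?t k P / fact k) = (\<Sum>k\<le>M. conv_power ?t (Suc k) P / fact (Suc k))"
    unfolding sum.atMost_Suc_shift using assms by simp
  also have "prod block_weight P * \<dots> \<le>
      prod block_weight P * (\<Sum>k\<le>M. ?t P * (\<Prod>i=1..k. 1 / (2 * real i) + 5 / (2 * sum block_weight P)))"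
    using assms finite_P card_block_pos
    by (intro mult_left_mono sum_mono forest_weight_le prod_nonneg) (auto simp: Suc_leI)
  also have "\<dots> = real (card (trees P)) *
      (\<Sum>k<card P. \<Prod>i=1..k. 1 / (2 * real i) + 5 / (2 * sum block_weight P))"
    using card_trees[of P] assms by (simp add: sum_distrib_left[symmetric] M lessThan_Suc_atMost)
  finally show ?thesis
    using card_Union_blocks[of P] by simp
qed

end

section \<open>Summing the ratio bounds\<close>

text \<open>With \<open>a = - 1 - 1 / (2 * b)\<close> the factor \<open>1 / (2 * i) + b\<close>
  equals \<open>(a - (i - 1)) * (- b) / i\<close>, so the series is the binomial series of
  \<open>1 - b\<close> with exponent \<open>a\<close>.\<close>

lemma forest_ratio_sums:
  fixes b :: real
  assumes "0 < b" "b < 1"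
  shows "(\<lambda>k. \<Prod>i=1..k. 1 / (2 * real i) + b) sums ((1 - b) powr (- 1 - 1 / (2 * b)))"
proof -
  define a where "a = - 1 - 1 / (2 * b)"
  have "(\<Prod>i=1..k. 1 / (2 * real i) + b) = (a gchoose k) * (- b) ^ k" for k
  proof (induction k)
    case (Suc k)
    have "(a gchoose Suc k) = (a gchoose k) * (a - real k) / real (Suc k)"
      by (simp add: gbinomial_prod_rev prod.atLeast0_lessThan_Suc)
    moreover have "(a - real k) * (- b) = b * real (Suc k) + 1 / 2"
      using assms by (simp add: a_def field_simps)
    then have "1 / (2 * real (Suc k)) + b = (a - real k) * (- b) / real (Suc k)"
      by (simp add: add_divide_distrib del: of_nat_Suc)
    ultimately show ?case
      using Suc by simp
  qed simp
  moreover have "(\<lambda>k. (a gchoose k) * (- b) ^ k) sums (1 + (- b)) powr a"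
    using assms by (intro gen_binomial_real) auto
  ultimately show ?thesis
    by (simp add: a_def)
qed

lemma forest_ratio_le:
  assumes "W \<ge> (3 :: nat)"
  shows "(\<Sum>k<n. \<Prod>i=1..k. 1 / (2 * real i) + 5 / (2 * real W)) \<le>
    (1 - 5 / (2 * real W)) powr (- 1 - real W / 5)"
proof -
  let ?b = "5 / (2 * real W)"
  \<comment> \<open>\<open>3\<close> is the least natural number \<open>W\<close> with
    \<open>5 / (2 * W) < 1\<close>.\<close>
  have b: "0 < ?b" "?b < 1"
    using assms by (auto simp: field_simps)
  have "(\<Sum>k<n. \<Prod>i=1..k. 1 / (2 * real i) + ?b) \<le> (\<Sum>k. \<Prod>i=1..k. 1 / (2 * real i) + ?b)"
    using forest_ratio_sums[OF b]
    by (intro sum_le_suminf prod_nonneg) (auto simp: sums_iff)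
  also have "\<dots> = (1 - ?b) powr (- 1 - 1 / (2 * ?b))"
    using forest_ratio_sums[OF b] by (simp add: sums_iff)
  finally show ?thesis
    by simp
qed

text \<open>The coefficient \<open>- 5 / 2\<close> in the base times \<open>- 1 / 5\<close> in the
  exponent gives \<open>1 / 2\<close>.\<close>

lemma forest_ratio_limit:
  "((\<lambda>W::nat. (1 - 5 / (2 * real W)) powr (- 1 - real W / 5)) \<longlongrightarrow> exp (1 / 2)) at_top"
  by real_asymp

section \<open>Bridges and cores\<close>

lemma equiv_reach_rel: "equiv V (reach_rel V E)"
  by (rule equivI) (auto simp: reach_rel_def refl_on_def sym_def trans_def intro: con_sym rtrancl_trans)

text \<open>Passes from counting components to reachability. Deleting an edge refines the
  components, and the new ones map onto the old ones; equal counts would make this map injective and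
  leave \<open>u\<close> and \<open>v\<close> in one new component.\<close>

lemma is_bridge_iff:
  assumes fin: "finite V" and E: "E \<in> graphs_on V"
  shows "is_bridge V E {u, v} \<longleftrightarrow> {u, v} \<in> E \<and> (u, v) \<notin> con (E - {{u, v}})"
proof (intro iffI conjI notI)
  assume "is_bridge V E {u, v}"
  then have e: "{u, v} \<in> E"
    and less: "card (graph_components V (E - {{u, v}})) > card (graph_components V E)"
    by (simp_all add: is_bridge_def)
  show "{u, v} \<in> E"
    by (rule e)
  assume c: "(u, v) \<in> con (E - {{u, v}})"
  have "(x, y) \<in> con (E - {{u, v}})" if "(x, y) \<in> con E" for x y
  proof -
    have "(x, y) \<in> con (insert {u, v} (E - {{u, v}}))"
      using that e by (simp add: insert_absorb)
    from con_insertD[OF this] show ?thesis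
      using c con_sym[OF c] by (blast intro: rtrancl_trans)
  qed
  then have "reach_rel V (E - {{u, v}}) = reach_rel V E"
    using con_mono[of "E - {{u, v}}" E] by (auto simp: reach_rel_def)
  with less show False
    by (simp add: graph_components_def)
next
  assume "{u, v} \<in> E \<and> (u, v) \<notin> con (E - {{u, v}})"
  then have e: "{u, v} \<in> E" and n: "(u, v) \<notin> con (E - {{u, v}})"
    by auto
  have uv: "u \<in> V" "v \<in> V"
    using e E by (auto simp: graphs_on_def)
  let ?R = "reach_rel V E"
  let ?R' = "reach_rel V (E - {{u, v}})"
  have sub: "?R' \<subseteq> ?R"
    using con_mono[of "E - {{u, v}}" E] by (auto simp: reach_rel_def)
  have im: "?R `` (?R' `` {x}) = ?R `` {x}" if "x \<in> V" for x
  proof -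
    have "x \<in> ?R' `` {x}"
      using that by (simp add: reach_rel_def)
    moreover have "?R `` {y} = ?R `` {x}" if "y \<in> ?R' `` {x}" for y
      using that sub equiv_class_eq[OF equiv_reach_rel, of x y V E] by auto
    ultimately show ?thesis
      by blast
  qed
  have surj: "V // ?R = (\<lambda>C. ?R `` C) ` (V // ?R')"
    unfolding quotient_def using im by auto
  have fin': "finite (V // ?R')"
    using fin by (simp add: quotient_def)
  have "card (V // ?R) \<noteq> card (V // ?R')"
  proof
    assume "card (V // ?R) = card (V // ?R')"
    then have inj: "inj_on (\<lambda>C. ?R `` C) (V // ?R')"
      using fin' unfolding surj by (rule eq_card_imp_inj_on[rotated])
    have "(u, v) \<in> ?R"
      using uv e con_edge by (auto simp: reach_rel_def)
    then have "?R `` (?R' `` {u}) = ?R `` (?R' `` {v})"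
      using im uv equiv_class_eq[OF equiv_reach_rel] by metis
    then have "?R' `` {u} = ?R' `` {v}"
      using inj_onD[OF inj, of "?R' `` {u}" "?R' `` {v}"] quotientI[OF uv(1)] quotientI[OF uv(2)] by blast
    then have "(u, v) \<in> ?R'"
      using eq_equiv_class[OF _ equiv_reach_rel] uv by metis
    with n show False
      by (simp add: reach_rel_def)
  qed
  moreover have "card (V // ?R) \<le> card (V // ?R')"
    unfolding surj using fin' by (rule card_image_le)
  ultimately show "is_bridge V E {u, v}"
    using e by (simp add: is_bridge_def graph_components_def)
qed

lemma forest_over_disjoint:
  assumes "forest_over G F" "F \<in> graphs_on V"
  shows "G \<inter> F = {}"
proof -
  have False if e: "e \<in> G" "e \<in> F" for e
  proof -
    obtain u v where uv: "e = {u, v}"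
      using edge_elem[OF assms(2) e(2)] by metis
    then have "(u, v) \<in> con (G \<union> (F - {{u, v}}))"
      using e by (intro con_edge) simp
    then show False
      using assms(1) e uv by (auto simp: forest_over_def)
  qed
  then show ?thesis
    by blast
qed

text \<open>The edges of \<open>F\<close> are added one at a time; each is a bridge at the moment
  when it is added.\<close>

lemma bridge_alterable_forest:
  assumes "finite V" "bridge_alterable V A" "G \<in> graphs_on V" "F \<in> graphs_on V" "forest_over G F"
  shows "G \<union> F \<in> A \<longleftrightarrow> G \<in> A"
proof -
  have "finite F"
    using assms(1,4) finite_subset[of F "Pow V"] by (auto simp: graphs_on_def)
  then show ?thesis
    using assms(4,5)
  proof (induction F rule: finite_induct)
    case (insert e F)
    obtain u v where e: "e = {u, v}"
      using edge_elem[OF insert.prems(1) insertI1] by metis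
    have F: "F \<in> graphs_on V" "forest_over G F"
      using insert.prems forest_over_subset[OF insert.prems(2), of F] by (auto simp: graphs_on_def)
    have eG: "e \<notin> G"
      using forest_over_disjoint[OF insert.prems(2,1)] by blast
    have H: "G \<union> insert e F \<in> graphs_on V"
      using assms(3) insert.prems(1) by (auto simp: graphs_on_def)
    have rem: "G \<union> insert e F - {e} = G \<union> F"
      using eG insert.hyps(2) by auto
    have "(u, v) \<notin> con (G \<union> (insert e F - {{u, v}}))"
      using insert.prems(2) e by (simp add: forest_over_def)
    moreover have "G \<union> (insert e F - {{u, v}}) = G \<union> F"
      using insert.hyps(2) e by auto
    ultimately have "is_bridge V (G \<union> insert e F) e"
      using is_bridge_iff[OF assms(1) H, of u v] rem e by simp
    then have "G \<union> insert e F \<in> A \<longleftrightarrow> G \<union> F \<in> A"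
      using assms(2) H rem unfolding bridge_alterable_def by metis
    then show ?case
      using insert.IH[OF F] by simp
  qed simp
qed

text \<open>Forest edges do not help to close a cycle through an edge of \<open>G\<close>: a detour
  through a forest edge \<open>{u, v}\<close>, closed up by \<open>{x, y}\<close>, would connect
  \<open>u\<close> and \<open>v\<close> without \<open>{u, v}\<close>.\<close>

lemma con_remove_forest:
  assumes "finite F" "F \<in> graphs_on V" "forest_over G F" "{x, y} \<in> G"
    and "(x, y) \<in> con (G \<union> F - {{x, y}})"
  shows "(x, y) \<in> con (G - {{x, y}})"
  using assms(1,2,3,5)
proof (induction F rule: finite_induct)
  case (insert e F)
  obtain u v where e: "e = {u, v}"
    using edge_elem[OF insert.prems(1) insertI1] by metis
  have F: "F \<in> graphs_on V" "forest_over G F"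
    using insert.prems forest_over_subset[OF insert.prems(2), of F] by (auto simp: graphs_on_def)
  have "(u, v) \<notin> con (G \<union> (insert e F - {{u, v}}))"
    using insert.prems(2) e by (simp add: forest_over_def)
  moreover have "G \<union> (insert e F - {{u, v}}) = G \<union> F"
    using insert.hyps(2) e by auto
  ultimately have n: "(u, v) \<notin> con (G \<union> F)"
    by simp
  have xy: "(x, y) \<in> con (G \<union> F)"
    using assms(4) by (intro con_edge) simp
  have mono: "(a, b) \<in> con (G \<union> F)" if "(a, b) \<in> con (G \<union> F - {{x, y}})" for a b
    using that by (rule con_mono[rotated]) blast
  have "(x, y) \<in> con (insert {u, v} (G \<union> F - {{x, y}}))"
    using insert.prems(3) by (rule con_mono[rotated]) (use e in blast)
  from con_insertD[OF this] have "(x, y) \<in> con (G \<union> F - {{x, y}})"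
  proof (elim disjE conjE)
    assume "(x, u) \<in> con (G \<union> F - {{x, y}})" "(v, y) \<in> con (G \<union> F - {{x, y}})"
    then have "(u, v) \<in> con (G \<union> F)"
      using xy mono by (meson con_sym rtrancl_trans)
    with n show ?thesis ..
  next
    assume "(x, v) \<in> con (G \<union> F - {{x, y}})" "(u, y) \<in> con (G \<union> F - {{x, y}})"
    then have "(u, v) \<in> con (G \<union> F)"
      using xy mono by (meson con_sym rtrancl_trans)
    with n show ?thesis ..
  qed
  then show ?case
    by (rule insert.IH[OF F])
qed simp

section \<open>Bridgeless cores\<close>

definition bridges :: "'a set \<Rightarrow> 'a set set \<Rightarrow> 'a set set" where
  "bridges V E = {e. is_bridge V E e}"

lemma bridges_subset: "bridges V E \<subseteq> E"
  by (auto simp: bridges_def is_bridge_def)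

lemma forest_over_bridges:
  assumes "finite V" "H \<in> graphs_on V"
  shows "forest_over (H - bridges V H) (bridges V H)"
  unfolding forest_over_def
proof (intro allI impI)
  fix u v assume e: "{u, v} \<in> bridges V H"
  then have "H - bridges V H \<union> (bridges V H - {{u, v}}) = H - {{u, v}}"
    using bridges_subset by blast
  then show "(u, v) \<notin> con (H - bridges V H \<union> (bridges V H - {{u, v}}))"
    using e is_bridge_iff[OF assms, of u v] by (simp add: bridges_def)
qed

text \<open>A core edge lies on a cycle of \<open>H\<close>; \<open>con_remove_forest\<close> moves
  the cycle into the core, where it survives the addition of any forest. So no core edge becomes a
  bridge.\<close>

lemma bridges_core_union_forest:
  assumes fin: "finite V" and H: "H \<in> graphs_on V" and F: "F \<in> graphs_on V"
    and forest: "forest_over (H - bridges V H) F"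
  shows "bridges V (H - bridges V H \<union> F) = F"
proof -
  let ?G = "H - bridges V H"
  have GF: "?G \<union> F \<in> graphs_on V"
    using H F by (auto simp: graphs_on_def)
  have dis: "?G \<inter> F = {}"
    by (rule forest_over_disjoint[OF forest F])
  have B: "bridges V H \<in> graphs_on V"
    using bridges_subset[of V H] H by (auto simp: graphs_on_def)
  have finB: "finite (bridges V H)"
    using B fin finite_subset[of "bridges V H" "Pow V"] by (auto simp: graphs_on_def)
  have "is_bridge V (?G \<union> F) e \<longleftrightarrow> e \<in> F" for e
  proof
    assume e: "e \<in> F"
    obtain u v where uv: "e = {u, v}"
      using edge_elem[OF F e] by metis
    have "?G \<union> F - {{u, v}} = ?G \<union> (F - {{u, v}})"
      using dis e uv by blast
    moreover have "(u, v) \<notin> con (?G \<union> (F - {{u, v}}))"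
      using forest e uv by (auto simp: forest_over_def)
    ultimately show "is_bridge V (?G \<union> F) e"
      using is_bridge_iff[OF fin GF, of u v] e uv by simp
  next
    assume b: "is_bridge V (?G \<union> F) e"
    then have e: "e \<in> ?G \<union> F"
      by (simp add: is_bridge_def)
    obtain u v where uv: "e = {u, v}"
      using edge_elem[OF GF e] by metis
    have n: "(u, v) \<notin> con (?G \<union> F - {{u, v}})"
      using is_bridge_iff[OF fin GF, of u v] b uv by simp
    show "e \<in> F"
    proof (rule ccontr)
      assume "e \<notin> F"
      then have eG: "{u, v} \<in> ?G"
        using e uv by blast
      then have "\<not> is_bridge V H {u, v}" "{u, v} \<in> H"
        by (auto simp: bridges_def)
      then have "(u, v) \<in> con (H - {{u, v}})"
        using is_bridge_iff[OF fin H, of u v] by simp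
      moreover have "?G \<union> bridges V H = H"
        using bridges_subset by blast
      ultimately have "(u, v) \<in> con (?G - {{u, v}})"
        using con_remove_forest[OF finB B forest_over_bridges[OF fin H] eG] by simp
      then have "(u, v) \<in> con (?G \<union> F - {{u, v}})"
        by (rule con_mono[rotated]) blast
      with n show False ..
    qed
  qed
  then show ?thesis
    by (auto simp: bridges_def)
qed

text \<open>Turns a class of graphs with a common core into an explicit set of forests that depends
  on \<open>A\<close> only through the core.\<close>

lemma core_class_eq:
  assumes fin: "finite V" and A: "bridge_alterable V A" and H: "H \<in> A"
  defines "G \<equiv> H - bridges V H"
  shows "{H' \<in> A. H' - bridges V H' = G} = (\<lambda>F. G \<union> F) ` {F \<in> graphs_on V. forest_over G F}"
proof -
  have AV: "A \<subseteq> graphs_on V"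
    using A by (simp add: bridge_alterable_def)
  have GV: "G \<in> graphs_on V"
    using AV H by (auto simp: G_def graphs_on_def)
  have dec: "bridges V H' \<in> graphs_on V" "H' = (H' - bridges V H') \<union> bridges V H'" if "H' \<in> A" for H'
    using that AV bridges_subset[of V H'] by (auto simp: graphs_on_def)
  \<comment> \<open>Deleting the bridges of \<open>H\<close> leads to its core, which therefore
    belongs to \<open>A\<close> itself.\<close>
  have GA: "G \<in> A"
    using bridge_alterable_forest[OF fin A GV dec(1)[OF H]] forest_over_bridges[OF fin, of H] H AV dec(2)[OF H]
    unfolding G_def by auto
  show ?thesis
  proof (intro equalityI subsetI)
    fix H' assume "H' \<in> {H' \<in> A. H' - bridges V H' = G}"
    then have H': "H' \<in> A" "H' - bridges V H' = G"
      by auto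
    then have "forest_over G (bridges V H')"
      using forest_over_bridges[OF fin, of H'] AV by auto
    moreover have "H' = G \<union> bridges V H'"
      using dec(2)[OF H'(1)] H'(2) by simp
    ultimately show "H' \<in> (\<lambda>F. G \<union> F) ` {F \<in> graphs_on V. forest_over G F}"
      using dec(1)[OF H'(1)] by blast
  next
    fix H' assume "H' \<in> (\<lambda>F. G \<union> F) ` {F \<in> graphs_on V. forest_over G F}"
    then obtain F where F: "H' = G \<union> F" "F \<in> graphs_on V" "forest_over G F"
      by blast
    have "H' \<in> A"
      using bridge_alterable_forest[OF fin A GV F(2,3)] GA F(1) by simp
    moreover have "bridges V H' = F"
      using bridges_core_union_forest[OF fin _ F(2), of H] F AV H unfolding G_def by auto
    moreover have "G \<inter> F = {}"
      by (rule forest_over_disjoint[OF F(3,2)])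
    ultimately show "H' \<in> {H' \<in> A. H' - bridges V H' = G}"
      using F(1) by auto
  qed
qed

text \<open>With the components of the core as blocks, the class corresponds to
  \<open>forests P\<close> and its connected members to \<open>trees P\<close>.\<close>

lemma card_core_class_le:
  assumes fin: "finite V" and ne: "V \<noteq> {}" and A: "bridge_alterable V A" and H: "H \<in> A"
    and W: "card V \<ge> 3"
  defines "C \<equiv> {H' \<in> A. H' - bridges V H' = H - bridges V H}"
  shows "real (card C) \<le> real (card {H' \<in> C. graph_connected V H'}) *
    (1 - 5 / (2 * real (card V))) powr (- 1 - real (card V) / 5)"
proof -
  define G where "G = H - bridges V H"
  have HV: "H \<in> graphs_on V"
    using A H by (auto simp: bridge_alterable_def)
  then have GV: "G \<in> graphs_on V"
    by (auto simp: G_def graphs_on_def)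
  \<comment> \<open>Isolated vertices become singleton blocks, so that
    \<open>\<Union>P = V\<close>.\<close>
  define P where "P = (\<lambda>u. con G `` {u}) ` V"
  have stay: "con G `` {u} \<subseteq> V" if "u \<in> V" for u
  proof
    fix v assume "v \<in> con G `` {u}"
    then have "(u, v) \<in> con G"
      by simp
    from con_local[OF this that, of G] show "v \<in> V"
      using GV by (auto simp: graphs_on_def)
  qed
  have UP: "\<Union>P = V"
    using stay by (auto simp: P_def)
  interpret blocks G P
  proof
    show "finite P"
      using fin by (simp add: P_def)
    show "finite b" if "b \<in> P" for b
      using that fin stay by (auto simp: P_def intro: finite_subset)
    show "b \<noteq> {}" if "b \<in> P" for b
      using that by (auto simp: P_def)
    show "con G `` {u} = b" if b: "b \<in> P" "u \<in> b" for b u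
    proof -
      obtain x where x: "b = con G `` {x}"
        using b(1) by (auto simp: P_def)
      then have "(x, u) \<in> con G"
        using b(2) by simp
      then show ?thesis
        unfolding x using con_sym[of x u G] by (auto intro: rtrancl_trans)
    qed
    show "card e = 2" if "e \<in> G" for e
      using that GV by (auto simp: graphs_on_def)
  qed
  have C: "C = (\<lambda>F. G \<union> F) ` forests P"
    unfolding forests_def UP C_def using core_class_eq[OF fin A H] by (simp only: G_def[symmetric])
  have inj: "inj_on (\<lambda>F. G \<union> F) (forests P)"
  proof (rule inj_onI)
    fix F F' assume F: "F \<in> forests P" "F' \<in> forests P" "G \<union> F = G \<union> F'"
    have "G \<inter> F = {}" "G \<inter> F' = {}"
      using F forest_over_disjoint[of G F V] forest_over_disjoint[of G F' V] by (auto simp: forests_def UP)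
    with F(3) show "F = F'"
      by blast
  qed
  have conn: "graph_connected V (G \<union> F) \<longleftrightarrow> F \<in> trees P" if "F \<in> forests P" for F
    using that ne by (auto simp: graph_connected_def trees_def UP reach_rel_def)
  have "{H' \<in> C. graph_connected V H'} = (\<lambda>F. G \<union> F) ` trees P"
    unfolding C using conn by (auto simp: trees_def)
  moreover have "inj_on (\<lambda>F. G \<union> F) (trees P)"
    using inj by (rule inj_on_subset) (auto simp: trees_def)
  ultimately have cT: "card {H' \<in> C. graph_connected V H'} = card (trees P)"
    by (simp add: card_image)
  have cF: "card C = card (forests P)"
    unfolding C using inj by (rule card_image)
  have "P \<noteq> {}"
    using ne by (simp add: P_def)
  from card_forests_le[OF this] forest_ratio_le[OF W, of "card P"] show ?thesis
    unfolding cT cF UP by (meson mult_left_mono of_nat_0_le_iff order_trans)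
qed

section \<open>The uniform bound and its limit\<close>

text \<open>The ratio bound depends only on \<open>card V\<close>, so it can be summed over all
  cores that occur in \<open>A\<close>.\<close>

lemma prob_connected_ge:
  assumes fin: "finite V" and A: "bridge_alterable V A" "A \<noteq> {}" and W: "card V \<ge> 3"
  shows "1 \<le> measure_pmf.prob (pmf_of_set A) {G. graph_connected V G} *
    (1 - 5 / (2 * real (card V))) powr (- 1 - real (card V) / 5)"
proof -
  let ?K = "(1 - 5 / (2 * real (card V))) powr (- 1 - real (card V) / 5)"
  let ?core = "\<lambda>H. H - bridges V H"
  let ?C = "\<lambda>G. {H \<in> A. ?core H = G}"
  have finA: "finite A"
    using A finite_graphs_on[OF fin] by (auto simp: bridge_alterable_def intro: finite_subset)
  have ne: "V \<noteq> {}"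
    using W by auto
  have "real (card A) = (\<Sum>G\<in>?core ` A. real (card (?C G)))"
    using sum.image_gen[OF finA, of "\<lambda>_. 1 :: real" ?core] by simp
  also have "\<dots> \<le> (\<Sum>G\<in>?core ` A. real (card {H \<in> ?C G. graph_connected V H}) * ?K)"
  proof (rule sum_mono)
    fix G assume "G \<in> ?core ` A"
    then obtain H where "H \<in> A" "G = ?core H"
      by blast
    then show "real (card (?C G)) \<le> real (card {H \<in> ?C G. graph_connected V H}) * ?K"
      using card_core_class_le[OF fin ne A(1) _ W, of H] by simp
  qed
  also have "\<dots> = (\<Sum>G\<in>?core ` A. \<Sum>H\<in>?C G. if graph_connected V H then 1 else 0) * ?K"
  proof -
    have "(\<Sum>H\<in>?C G. if graph_connected V H then 1 else 0) = real (card {H \<in> ?C G. graph_connected V H})" for G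
      by (subst sum.inter_filter[symmetric]) (use finA in auto)
    then show ?thesis
      by (simp only: sum_distrib_right)
  qed
  also have "(\<Sum>G\<in>?core ` A. \<Sum>H\<in>?C G. if graph_connected V H then 1 else 0) =
      (\<Sum>H\<in>A. if graph_connected V H then 1 else (0 :: real))"
    by (rule sum.image_gen[OF finA, symmetric])
  also have "\<dots> = real (card (A \<inter> {G. graph_connected V G}))"
    using finA by (simp add: sum.If_cases)
  finally have "real (card A) \<le> real (card (A \<inter> {G. graph_connected V G})) * ?K" .
  moreover have "card A > 0"
    using finA A by (simp add: card_gt_0_iff)
  ultimately show ?thesis
    using finA A by (simp add: measure_pmf_of_set field_simps)
qed

theorem theorem1:
  fixes \<epsilon> :: real
  assumes "\<epsilon> > 0"
  shows "\<exists>W0::nat. \<forall>W\<ge>W0. \<forall>A :: nat set set set.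
           A \<noteq> {} \<and> bridge_alterable {1..W} A \<longrightarrow>
           measure_pmf.prob (pmf_of_set A) {G. graph_connected {1..W} G} \<ge> (1 - \<epsilon>) * exp (- 1 / 2)"
proof -
  \<comment> \<open>\<open>K W\<close> bounds the ratio of all graphs in the class to the connected
    ones, and it tends to \<open>exp (1 / 2)\<close>.\<close>
  define K where "K W = (1 - 5 / (2 * real W)) powr (- 1 - real W / 5)" for W :: nat
  have "((\<lambda>W. (1 - \<epsilon>) * exp (- 1 / 2) * K W) \<longlongrightarrow> (1 - \<epsilon>) * exp (- 1 / 2) * exp (1 / 2)) at_top"
    unfolding K_def by (intro tendsto_intros forest_ratio_limit)
  moreover have "(1 - \<epsilon>) * exp (- 1 / 2) * exp (1 / 2) < 1"
    using assms by (simp add: mult.assoc flip: exp_add)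
  ultimately have "eventually (\<lambda>W. (1 - \<epsilon>) * exp (- 1 / 2) * K W < 1) at_top"
    by (rule order_tendstoD(2))
  then obtain W1 where W1: "\<And>W. W \<ge> W1 \<Longrightarrow> (1 - \<epsilon>) * exp (- 1 / 2) * K W < 1"
    by (auto simp: eventually_at_top_linorder)
  show ?thesis
  \<comment> \<open>\<open>W1\<close> comes from the limit, and \<open>3\<close> is required by
    \<open>prob_connected_ge\<close>.\<close>
  proof (intro exI[of _ "max W1 3"] allI impI)
    fix W :: nat and A :: "nat set set set"
    assume W: "max W1 3 \<le> W" and A: "A \<noteq> {} \<and> bridge_alterable {1..W} A"
    let ?p = "measure_pmf.prob (pmf_of_set A) {G. graph_connected {1..W} G}"
    have "1 \<le> ?p * K W"
      using prob_connected_ge[of "{1..W}" A] A W by (simp add: K_def)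
    with W1[of W] W have "(1 - \<epsilon>) * exp (- 1 / 2) * K W < ?p * K W"
      by simp
    \<comment> \<open>Non-negativity suffices for cancelling \<open>K W\<close>, as the inequality
      is strict.\<close>
    moreover have "K W \<ge> 0"
      by (simp add: K_def)
    ultimately show "?p \<ge> (1 - \<epsilon>) * exp (- 1 / 2)"
      using mult_less_cancel_right[of "(1 - \<epsilon>) * exp (- 1 / 2)" "K W" ?p] by linarith
  qed
qed

end
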